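(* There is an algorithm which, given a known integer $n\ge 1$, a parameter $\varepsilon\in(0,1/2]$, and sample access (independent samples) to two unknown probability distributions $p,q$ over $[n]=\{1,\dots,n\}$, takes \[ O\!\left(\frac{n^{3/4}\log(n/\varepsilon)\cdot\log n}{\varepsilon}+\frac{\log^2(n/\varepsilon)}{\varepsilon^2}\right) \] samples from each of $p$ and $q$ and satisfies: (i) if $p=q$, it outputs accept with probability at least $9/10$; (ii) if $|H(p)-H(q)|\ge\varepsilon$, it outputs reject with probability at least $9/10$. Moreover, the algorithm runs in time $O(N\log N)$, where $N$ is the total number of samples it takes.
   Context: For a distribution $p$ over a finite set, $H(p)=\sum_x p(x)\log\frac{1}{p(x)}$ denotes its Shannon entropy (natural logarithm). The task of distinguishing $p=q$ from $|H(p)-H(q)|\ge\varepsilon$ is called Entropy Equivalence Testing. *)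

theory Defs
  imports "HOL-Probability.Probability"
begin

text \<open>The summand vanishes at points of probability zero, so summing over the support is
  the same as summing over the whole domain.\<close>

definition shannon_entropy :: "nat pmf \<Rightarrow> real" where
  "shannon_entropy p = (\<Sum>x\<in>set_pmf p. pmf p x * ln (1 / pmf p x))"


text \<open>Algorithms are programs of a unit-cost random access machine with sample access to two
  distributions. The machine has two memories, both initially zero: one of natural numbers, which
  also supplies the addresses, and one of exact reals. Natural-number arithmetic is limited to
  addition and truncated subtraction, so that no large words arise in few steps. Reals have
  field operations, logarithm and comparison, but there is no rounding of reals to naturals and the
  only constants are natural numbers, so a program can carry no real-valued advice. Division by zero
  and logarithms of nonpositive numbers take their conventional HOL values instead of failing.\<close>

datatype nexp =
    NConst nat
  | NLoad nexp
  | NAdd nexp nexp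
  | NSub nexp nexp

datatype rexp =
    RNat nexp
  | RLoad nexp
  | RAdd rexp rexp
  | RSub rexp rexp
  | RMul rexp rexp
  | RDiv rexp rexp
  | RLn rexp

datatype test =
    NLess nexp nexp
  | RLess rexp rexp
  | Neg test
  | Conj test test

text \<open>The first argument of the storing commands is the address that is written.\<close>

datatype com =
    Skip
  | NStore nexp nexp
  | RStore nexp rexp
  | SampleP nexp
  | SampleQ nexp
  | Flip nexp
  | Seq com com
  | Cond test com com
  | Loop test com

text \<open>The last three fields are bookkeeping that programs cannot read.\<close>

record state =
  nmem :: "nat \<Rightarrow> nat"
  rmem :: "nat \<Rightarrow> real"
  used_p :: nat
  used_q :: nat
  steps :: nat

primrec nval :: "nexp \<Rightarrow> state \<Rightarrow> nat" where
  "nval (NConst k) s = k"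
| "nval (NLoad a) s = nmem s (nval a s)"
| "nval (NAdd a b) s = nval a s + nval b s"
| "nval (NSub a b) s = nval a s - nval b s"

primrec rval :: "rexp \<Rightarrow> state \<Rightarrow> real" where
  "rval (RNat a) s = real (nval a s)"
| "rval (RLoad a) s = rmem s (nval a s)"
| "rval (RAdd a b) s = rval a s + rval b s"
| "rval (RSub a b) s = rval a s - rval b s"
| "rval (RMul a b) s = rval a s * rval b s"
| "rval (RDiv a b) s = rval a s / rval b s"
| "rval (RLn a) s = ln (rval a s)"

primrec tval :: "test \<Rightarrow> state \<Rightarrow> bool" where
  "tval (NLess a b) s \<longleftrightarrow> nval a s < nval b s"
| "tval (RLess a b) s \<longleftrightarrow> rval a s < rval b s"
| "tval (Neg t) s \<longleftrightarrow> \<not> tval t s"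
| "tval (Conj t u) s \<longleftrightarrow> tval t s \<and> tval u s"

definition nput :: "nat \<Rightarrow> nat \<Rightarrow> state \<Rightarrow> state" where
  "nput a v s = s\<lparr>nmem := (nmem s)(a := v)\<rparr>"

definition rput :: "nat \<Rightarrow> real \<Rightarrow> state \<Rightarrow> state" where
  "rput a v s = s\<lparr>rmem := (rmem s)(a := v)\<rparr>"

text \<open>One step of a program, where \<open>p\<close> and \<open>q\<close> are the sampled distributions. A program contains
  finitely many expressions, all of fixed size, so charging one step for evaluating an expression
  changes running times by at most a constant factor depending on the program.\<close>

primrec step :: "nat pmf \<Rightarrow> nat pmf \<Rightarrow> com \<Rightarrow> state \<Rightarrow> (com \<times> state) pmf" where
  "step p q Skip s = return_pmf (Skip, s)"
| "step p q (NStore a e) s = return_pmf (Skip, nput (nval a s) (nval e s) s)"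
| "step p q (RStore a e) s = return_pmf (Skip, rput (nval a s) (rval e s) s)"
| "step p q (SampleP a) s =
     map_pmf (\<lambda>x. (Skip, nput (nval a s) x (s\<lparr>used_p := used_p s + 1\<rparr>))) p"
| "step p q (SampleQ a) s =
     map_pmf (\<lambda>x. (Skip, nput (nval a s) x (s\<lparr>used_q := used_q s + 1\<rparr>))) q"
| "step p q (Flip a) s =
     map_pmf (\<lambda>b. (Skip, nput (nval a s) (of_bool b) s)) (bernoulli_pmf (1/2))"
| "step p q (Seq c d) s =
     (if c = Skip then return_pmf (d, s)
      else map_pmf (\<lambda>(c', s'). (Seq c' d, s')) (step p q c s))"
| "step p q (Cond t c d) s = return_pmf (if tval t s then c else d, s)"
| "step p q (Loop t c) s =
     return_pmf (if tval t s then Seq c (Loop t c) else Skip, s)"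

definition tick :: "com \<times> state \<Rightarrow> com \<times> state" where
  "tick = map_prod id (\<lambda>s. s\<lparr>steps := steps s + 1\<rparr>)"

text \<open>The distribution of configurations after \<open>t\<close> steps; a configuration that has
  halted stays as it is and is charged no further time.\<close>

primrec run :: "nat pmf \<Rightarrow> nat pmf \<Rightarrow> nat \<Rightarrow> com \<times> state \<Rightarrow> (com \<times> state) pmf" where
  "run p q 0 cfg = return_pmf cfg"
| "run p q (Suc t) cfg =
     (if fst cfg = Skip then return_pmf cfg
      else bind_pmf (map_pmf tick (step p q (fst cfg) (snd cfg))) (run p q t))"

text \<open>The inputs \<open>n\<close> and \<open>\<epsilon>\<close> are found at address 0 of the respective memories, and the verdict
  is left at address 0 of the natural-number memory.\<close>

definition start :: "nat \<Rightarrow> real \<Rightarrow> state" where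
  "start n \<epsilon> =
     \<lparr>nmem = (\<lambda>_. 0)(0 := n), rmem = (\<lambda>_. 0)(0 := \<epsilon>), used_p = 0, used_q = 0, steps = 0\<rparr>"

definition accepting :: "(com \<times> state) set" where
  "accepting = {(c, s). c = Skip \<and> nmem s 0 = 1}"

definition rejecting :: "(com \<times> state) set" where
  "rejecting = {(c, s). c = Skip \<and> nmem s 0 = 0}"

end

(* Write d = p - q and let mu = (p + q) / 2. A first batch of m samples of mu yields counts c i, hence
   the weights w i = 1 / (1 + c i) and the estimate ln (1 + c i) of ln (m * mu i). The next two
   batches give an unbiased estimate of the weighted norm m^2 * (SUM i. w i * d i^2), whose variance is
   O(n) if p = q, and of the mean difference m * (SUM i. d i * ln (1 + c i)).
   If the weighted norm is O(sqrt n), then by Cauchy-Schwarz the elements with m * mu i < 1 contribute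
   at most O(n^(3/4) * ln m / m) to the entropy difference, and on the others replacing ln (m * mu i) by
   ln (1 + c i) costs O(n^(3/4) / m), while the second-order terms are O(sqrt n / m). Hence the entropy
   difference is - (SUM i. d i * ln (1 + c i)) up to O(n^(3/4) * ln m / m), and the second estimate
   detects it. *)

theory Submission
  imports Defs
begin

section \<open>Finitely supported expectations and counts\<close>

text \<open>The weights are random, but the case split behind rejection is not: it is made on the
  deterministic norm \<open>D\<close>, in which each count is replaced by its mean
  \<open>lam i\<close>. Markov's inequality then relates \<open>D\<close> to the random norm when
  \<open>D\<close> is large, and controls the error of the logarithms of the counts when
  \<open>D\<close> is small. The norm is estimated by a bilinear form in the signed counts of two
  independent batches. This is unbiased without diagonal corrections, and it can be accumulated
  sample by sample; a sweep over the domain would cost \<open>n\<close> steps, although the number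
  of samples may be sublinear in \<open>n\<close>. The machine neither takes roots nor rounds reals
  to naturals, so the batch size cannot be computed from a formula. It is the least \<open>m\<close>
  that passes a polynomial test in \<open>m\<close> and \<open>ln (m + 1)\<close>, found by counting
  upwards in O(m) steps. The analysis itself yields the sample bound without the factor log n;
  passing to the stated bound needs care only at n = 1, where this factor vanishes.\<close>

abbreviation E :: "'a pmf \<Rightarrow> ('a \<Rightarrow> real) \<Rightarrow> real" where
  "E \<equiv> measure_pmf.expectation"

lemma E_cong: "(\<And>x. x \<in> set_pmf M \<Longrightarrow> f x = g x) \<Longrightarrow> E M f = E M g"
  by (intro integral_cong_AE) (auto simp: AE_measure_pmf_iff)

lemma E_add: "finite (set_pmf M) \<Longrightarrow> E M (\<lambda>x. f x + g x) = E M f + E M g"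
  by (intro Bochner_Integration.integral_add integrable_measure_pmf_finite)

lemma E_diff: "finite (set_pmf M) \<Longrightarrow> E M (\<lambda>x. f x - g x) = E M f - E M g"
  by (intro Bochner_Integration.integral_diff integrable_measure_pmf_finite)

lemma E_sum: "finite (set_pmf M) \<Longrightarrow> E M (\<lambda>x. \<Sum>i\<in>I. f i x) = (\<Sum>i\<in>I. E M (f i))"
  by (intro Bochner_Integration.integral_sum integrable_measure_pmf_finite)

lemma E_mono:
  "finite (set_pmf M) \<Longrightarrow> (\<And>x. x \<in> set_pmf M \<Longrightarrow> f x \<le> g x) \<Longrightarrow> E M f \<le> E M g"
  by (intro integral_mono_AE integrable_measure_pmf_finite) (auto simp: AE_measure_pmf_iff)

lemma E_nonneg: "(\<And>x. 0 \<le> f x) \<Longrightarrow> 0 \<le> E M f"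
  by (rule Bochner_Integration.integral_nonneg)

lemma E_bind:
  "finite (set_pmf M) \<Longrightarrow> (\<And>x. x \<in> set_pmf M \<Longrightarrow> finite (set_pmf (K x))) \<Longrightarrow>
    E (bind_pmf M K) f = E M (\<lambda>x. E (K x) f)"
  by (simp add: pmf_expectation_bind[of "set_pmf M"] integral_measure_pmf[of "set_pmf M"])

lemma E_pair:
  assumes "finite (set_pmf M)" "finite (set_pmf N)"
  shows "E (pair_pmf M N) f = E M (\<lambda>x. E N (\<lambda>y. f (x, y)))"
  unfolding pair_pmf_def using assms by (simp add: E_bind)

lemma E_pair_swap:
  assumes "finite (set_pmf M)" "finite (set_pmf N)"
  shows "E M (\<lambda>x. E N (\<lambda>y. f x y)) = E N (\<lambda>y. E M (\<lambda>x. f x y))"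
  using assms by (simp add: integral_measure_pmf[of "set_pmf M"] integral_measure_pmf[of "set_pmf N"]
      sum_distrib_left mult.left_commute) (rule sum.swap)

text \<open>Markov's inequality in the form used for all failure probabilities: \<open>f\<close>
  will be a sum of normalised errors, so that one application combines the union bound with Markov
  and Chebyshev.\<close>

lemma prob_le_E:
  assumes "finite (set_pmf M)" "\<And>x. 0 \<le> f x" "\<And>x. x \<in> A \<Longrightarrow> x \<in> set_pmf M \<Longrightarrow> 1 \<le> f x"
  shows "measure_pmf.prob M A \<le> E M f"
proof -
  have "measure_pmf.prob M A = E M (indicat_real A)" by simp
  also have "\<dots> \<le> E M f" using assms by (intro E_mono) (auto simp: indicator_def)
  finally show ?thesis .
qed

section \<open>Moments of independent draws: sums and counts\<close>

lemma finite_replicate_pmf [simp]: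
  "finite (set_pmf M) \<Longrightarrow> finite (set_pmf (replicate_pmf m M))"
  by (induction m) auto

lemma E_replicate_Suc:
  "finite (set_pmf M) \<Longrightarrow>
    E (replicate_pmf (Suc m) M) F = E M (\<lambda>x. E (replicate_pmf m M) (\<lambda>xs. F (x # xs)))"
  by (simp add: E_bind)

lemma iid_sum_mean:
  "finite (set_pmf M) \<Longrightarrow> E (replicate_pmf m M) (\<lambda>xs. \<Sum>x\<leftarrow>xs. g x) = real m * E M g"
proof (induction m)
  case (Suc m)
  then show ?case by (simp only: E_replicate_Suc) (simp add: E_add algebra_simps)
qed simp

lemma iid_sum_square:
  assumes "finite (set_pmf M)"
  shows "E (replicate_pmf m M) (\<lambda>xs. (\<Sum>x\<leftarrow>xs. g x)\<^sup>2) =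
    real m * E M (\<lambda>x. (g x)\<^sup>2) + real m * (real m - 1) * (E M g)\<^sup>2"
proof (induction m)
  case (Suc m)
  have "E (replicate_pmf (Suc m) M) (\<lambda>xs. (\<Sum>x\<leftarrow>xs. g x)\<^sup>2) =
    E M (\<lambda>x. E (replicate_pmf m M) (\<lambda>xs. (g x)\<^sup>2 + (2 * g x) * (\<Sum>x\<leftarrow>xs. g x) + (\<Sum>x\<leftarrow>xs. g x)\<^sup>2))"
    using assms by (simp only: E_replicate_Suc) (simp add: power2_sum algebra_simps)
  also have "\<dots> = E M (\<lambda>x. (g x)\<^sup>2 + (2 * real m * E M g) * g x +
      E (replicate_pmf m M) (\<lambda>xs. (\<Sum>x\<leftarrow>xs. g x)\<^sup>2))"
    using assms by (simp add: E_add iid_sum_mean algebra_simps)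
  also have "\<dots> = E M (\<lambda>x. (g x)\<^sup>2) + 2 * real m * E M g * E M g +
      E (replicate_pmf m M) (\<lambda>xs. (\<Sum>x\<leftarrow>xs. g x)\<^sup>2)"
    using assms by (simp add: E_add)
  also have "\<dots> = real (Suc m) * E M (\<lambda>x. (g x)\<^sup>2) + real (Suc m) * (real (Suc m) - 1) * (E M g)\<^sup>2"
    unfolding Suc.IH by (simp add: power2_eq_square algebra_simps)
  finally show ?case .
qed simp

lemma iid_sum_variance:
  assumes "finite (set_pmf M)"
  shows "E (replicate_pmf m M) (\<lambda>xs. ((\<Sum>x\<leftarrow>xs. g x) - real m * E M g)\<^sup>2)
    \<le> real m * E M (\<lambda>x. (g x)\<^sup>2)"
proof -
  let ?a = "real m * E M g"
  have "E (replicate_pmf m M) (\<lambda>xs. ((\<Sum>x\<leftarrow>xs. g x) - ?a)\<^sup>2) =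
    E (replicate_pmf m M) (\<lambda>xs. (\<Sum>x\<leftarrow>xs. g x)\<^sup>2 - (2 * ?a) * (\<Sum>x\<leftarrow>xs. g x) + ?a\<^sup>2)"
    by (simp add: power2_diff algebra_simps)
  also have "\<dots> = E (replicate_pmf m M) (\<lambda>xs. (\<Sum>x\<leftarrow>xs. g x)\<^sup>2) - 2 * ?a * ?a + ?a\<^sup>2"
    using assms by (simp add: E_add E_diff iid_sum_mean)
  also have "\<dots> = real m * E M (\<lambda>x. (g x)\<^sup>2) - real m * (E M g)\<^sup>2"
    unfolding iid_sum_square[OF assms] by (simp add: power2_eq_square algebra_simps)
  finally show ?thesis by simp
qed

text \<open>Conditioning on the first draw, which hits \<open>i\<close> with probability
  \<open>pmf M i\<close>.\<close>

lemma E_count_Suc: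
  assumes "finite (set_pmf M)"
  shows "E (replicate_pmf (Suc m) M) (\<lambda>xs. \<phi> (count_list xs i)) =
    pmf M i * E (replicate_pmf m M) (\<lambda>xs. \<phi> (Suc (count_list xs i))) +
    (1 - pmf M i) * E (replicate_pmf m M) (\<lambda>xs. \<phi> (count_list xs i))"
proof -
  let ?a = "E (replicate_pmf m M) (\<lambda>xs. \<phi> (Suc (count_list xs i)))"
  let ?b = "E (replicate_pmf m M) (\<lambda>xs. \<phi> (count_list xs i))"
  have "E (replicate_pmf (Suc m) M) (\<lambda>xs. \<phi> (count_list xs i)) =
      E M (\<lambda>x. ?b + (?a - ?b) * indicat_real {i} x)"
    using assms by (simp only: E_replicate_Suc) (intro E_cong, auto simp: indicator_def)
  also have "\<dots> = ?b + (?a - ?b) * pmf M i"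
    using assms by (subst E_add) (simp_all add: measure_pmf_single)
  finally show ?thesis by (simp add: algebra_simps)
qed

text \<open>The size-bias identity replaces all explicit binomial sums: both inverse moments of a count
  below follow by choosing \<open>\<phi>\<close>.\<close>

lemma E_count_size_bias:
  assumes "finite (set_pmf M)"
  shows "E (replicate_pmf (Suc m) M) (\<lambda>xs. real (count_list xs i) * \<phi> (count_list xs i)) =
    real (Suc m) * pmf M i * E (replicate_pmf m M) (\<lambda>xs. \<phi> (Suc (count_list xs i)))"
proof (induction m arbitrary: \<phi>)
  case 0
  show ?case using assms
    by (subst E_count_Suc[where \<phi> = "\<lambda>k. real k * \<phi> k"]) simp_all
next
  case (Suc m)
  let ?x = "pmf M i"
  let ?G = "\<lambda>m \<psi>. E (replicate_pmf m M) (\<lambda>xs. \<psi> (count_list xs i))"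
  have fin: "finite (set_pmf (replicate_pmf (Suc m) M))"
    using assms by (rule finite_replicate_pmf)
  have "?G (Suc (Suc m)) (\<lambda>k. real k * \<phi> k) =
      ?x * ?G (Suc m) (\<lambda>k. real (Suc k) * \<phi> (Suc k)) + (1 - ?x) * ?G (Suc m) (\<lambda>k. real k * \<phi> k)"
    using assms by (rule E_count_Suc)
  \<comment> \<open>\<open>Suc k = 1 + k\<close> splits off a summand without the factor
    \<open>k\<close>; the induction hypothesis applies to the other one, with \<open>\<phi>\<close>
    shifted. The one-draw recursion, read backwards, then reassembles the expectation.\<close>
  also have "?G (Suc m) (\<lambda>k. real (Suc k) * \<phi> (Suc k)) =
      ?G (Suc m) (\<lambda>k. \<phi> (Suc k)) + ?G (Suc m) (\<lambda>k. real k * \<phi> (Suc k))"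
    using fin by (subst E_add[symmetric]) (simp_all add: algebra_simps del: replicate_pmf.simps)
  also have "?x * (?G (Suc m) (\<lambda>k. \<phi> (Suc k)) + ?G (Suc m) (\<lambda>k. real k * \<phi> (Suc k)))
      + (1 - ?x) * ?G (Suc m) (\<lambda>k. real k * \<phi> k) =
      ?x * ?G (Suc m) (\<lambda>k. \<phi> (Suc k)) + real (Suc m) * ?x *
       (?x * ?G m (\<lambda>k. \<phi> (Suc (Suc k))) + (1 - ?x) * ?G m (\<lambda>k. \<phi> (Suc k)))"
    unfolding Suc.IH[of \<phi>] Suc.IH[of "\<lambda>k. \<phi> (Suc k)"] by (simp add: algebra_simps)
  also have "?x * ?G m (\<lambda>k. \<phi> (Suc (Suc k))) + (1 - ?x) * ?G m (\<lambda>k. \<phi> (Suc k)) =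
      ?G (Suc m) (\<lambda>k. \<phi> (Suc k))"
    using assms by (rule E_count_Suc[where \<phi> = "\<lambda>k. \<phi> (Suc k)", symmetric])
  finally show ?case by (simp add: algebra_simps del: replicate_pmf.simps)
qed

lemma E_count:
  "finite (set_pmf M) \<Longrightarrow> E (replicate_pmf m M) (\<lambda>xs. real (count_list xs i)) = real m * pmf M i"
  using E_count_size_bias[of M "m - 1" i "\<lambda>_. 1"] by (cases m) (simp_all del: replicate_pmf.simps(2))

text \<open>Size bias with \<open>\<phi> k = 1 / k\<close>: the product \<open>k * \<phi> k\<close>
  is 1 for positive \<open>k\<close> and 0 at \<open>k = 0\<close>, hence at most 1, while the shift
  turns \<open>\<phi>\<close> into the reciprocal of count plus one.\<close>

lemma E_inverse_count:
  assumes "finite (set_pmf M)"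
  shows "real (Suc m) * pmf M i * E (replicate_pmf m M) (\<lambda>xs. 1 / (1 + real (count_list xs i))) \<le> 1"
proof -
  have "real (Suc m) * pmf M i * E (replicate_pmf m M) (\<lambda>xs. 1 / real (Suc (count_list xs i))) =
      E (replicate_pmf (Suc m) M) (\<lambda>xs. real (count_list xs i) * (1 / real (count_list xs i)))"
    using assms by (rule E_count_size_bias[where \<phi> = "\<lambda>k. 1 / real k", symmetric])
  also have "\<dots> \<le> E (replicate_pmf (Suc m) M) (\<lambda>_. 1)"
    using assms by (intro E_mono finite_replicate_pmf) auto
  finally show ?thesis by (simp add: add.commute)
qed

text \<open>The square is compared with \<open>2 / ((k + 1) * (k + 2))\<close> because this product
  suits size bias: each of two applications removes one factor and extends the batch by one
  draw.\<close>

lemma E_inverse_count_square: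
  assumes "finite (set_pmf M)"
  shows "real (Suc m) * real (Suc (Suc m)) * (pmf M i)\<^sup>2 *
    E (replicate_pmf m M) (\<lambda>xs. (1 / (1 + real (count_list xs i)))\<^sup>2) \<le> 2"
proof -
  let ?x = "pmf M i"
  have *: "(1 / (1 + real k))\<^sup>2 \<le> 2 / (real (Suc k) * real (Suc (Suc k)))" for k
  proof -
    have "real (Suc k) * real (Suc (Suc k)) \<le> 2 * (1 + real k)\<^sup>2"
      by (simp add: power2_eq_square algebra_simps)
    then show ?thesis by (simp add: power_divide divide_simps mult_ac)
  qed
  have "real (Suc m) * ?x * E (replicate_pmf m M) (\<lambda>xs. (1 / (1 + real (count_list xs i)))\<^sup>2) \<le>
    real (Suc m) * ?x * E (replicate_pmf m M)
      (\<lambda>xs. 2 / (real (Suc (count_list xs i)) * real (Suc (Suc (count_list xs i)))))"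
    using assms by (intro mult_left_mono E_mono finite_replicate_pmf *) auto
  also have "\<dots> = E (replicate_pmf (Suc m) M) (\<lambda>xs. real (count_list xs i) *
      (2 / (real (count_list xs i) * real (Suc (count_list xs i)))))"
    using assms by (rule E_count_size_bias[where \<phi> = "\<lambda>k. 2 / (real k * real (Suc k))", symmetric])
  also have "\<dots> \<le> E (replicate_pmf (Suc m) M) (\<lambda>xs. 2 * (1 / (1 + real (count_list xs i))))"
    using assms by (intro E_mono finite_replicate_pmf) (auto simp: divide_simps)
  also have "\<dots> = 2 * E (replicate_pmf (Suc m) M) (\<lambda>xs. 1 / (1 + real (count_list xs i)))"
    by (rule integral_mult_right_zero)
  finally have "real (Suc (Suc m)) * ?x * (real (Suc m) * ?x *
      E (replicate_pmf m M) (\<lambda>xs. (1 / (1 + real (count_list xs i)))\<^sup>2)) \<le>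
    real (Suc (Suc m)) * ?x *
      (2 * E (replicate_pmf (Suc m) M) (\<lambda>xs. 1 / (1 + real (count_list xs i))))"
    by (rule mult_left_mono) simp
  also have "\<dots> = 2 * (real (Suc (Suc m)) * ?x *
      E (replicate_pmf (Suc m) M) (\<lambda>xs. 1 / (1 + real (count_list xs i))))"
    by (simp only: mult_ac)
  also have "\<dots> \<le> 2"
    using E_inverse_count[OF assms, of "Suc m" i] by (simp only:)
  finally show ?thesis
    by (simp add: power2_eq_square mult_ac del: replicate_pmf.simps of_nat_Suc)
qed

section \<open>Entropy differences\<close>

definition plogp :: "real \<Rightarrow> real" where
  "plogp x = x * ln (1 / x)"

text \<open>Equivalent to \<open>|ln x| \<le> |sqrt x - 1 / sqrt x|\<close>. The right side equals
  \<open>x - 2 + 1 / x\<close>, so at \<open>x = (1 + c) / lam\<close> its expectation involves only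
  the means of the count and of the weight; \<open>E_log_error\<close> rests on this.\<close>

lemma ln_square_le:
  fixes x :: real
  assumes "0 < x"
  shows "(ln x)\<^sup>2 \<le> (x - 1)\<^sup>2 / x"
proof -
  have *: "(ln x)\<^sup>2 \<le> (x - 1)\<^sup>2 / x" if "1 \<le> x" for x :: real
  proof -
    define y where "y = sqrt x"
    have y: "1 \<le> y" "x = y\<^sup>2" using that by (simp_all add: y_def)
    \<comment> \<open>The function vanishes at 1, and its derivative is a square.\<close>
    have "(\<lambda>y. y - 1 / y - 2 * ln y) 1 \<le> (\<lambda>y. y - 1 / y - 2 * ln y) y"
    proof (rule DERIV_nonneg_imp_nondecreasing[OF y(1)])
      fix t :: real assume t: "1 \<le> t" "t \<le> y"
      have "((\<lambda>y. y - 1 / y - 2 * ln y) has_real_derivative (1 - 1 / t)\<^sup>2) (at t)"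
        using t by (auto intro!: derivative_eq_intros simp: power2_eq_square field_simps)
      then show "\<exists>d. ((\<lambda>y. y - 1 / y - 2 * ln y) has_real_derivative d) (at t) \<and> 0 \<le> d"
        by (intro exI conjI) auto
    qed
    then have "ln x \<le> y - 1 / y" using y by (simp add: ln_realpow)
    moreover have "0 \<le> ln x" using that by simp
    ultimately have "(ln x)\<^sup>2 \<le> (y - 1 / y)\<^sup>2" by (rule power_mono)
    also have "\<dots> = (x - 1)\<^sup>2 / x" using y by (simp add: power2_eq_square field_simps)
    finally show ?thesis .
  qed
  show ?thesis
  proof (cases "1 \<le> x")
    case False
    \<comment> \<open>Both sides are invariant under replacing \<open>x\<close> by
      \<open>1 / x\<close>.\<close>
    then have "(ln (1 / x))\<^sup>2 \<le> (1 / x - 1)\<^sup>2 / (1 / x)" using assms by (intro *) auto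
    also have "\<dots> = (x - 1)\<^sup>2 / x" using assms by (simp add: power2_eq_square field_simps)
    finally show ?thesis using assms by (simp add: ln_div)
  qed (rule *)
qed

text \<open>\<open>ln y \<le> y - 1\<close> at \<open>y = x / \<mu>\<close> and at
  \<open>y = \<mu> / x\<close> traps \<open>plogp x\<close> between expressions that differ by
  \<open>(x - \<mu>)^2 / \<mu>\<close>. As \<open>p\<close> and \<open>q\<close> are equally far
  from \<open>\<mu>\<close>, both have the same error. The linear term \<open>p - q\<close> is kept
  because it cancels on summation over all elements.\<close>

lemma plogp_diff_near_mean:
  fixes p q :: real
  assumes "0 \<le> p" "0 \<le> q" "\<mu> = (p + q) / 2" "0 < \<mu>"
  shows "\<bar>plogp p - plogp q - (p - q) * ln (1 / \<mu>) + (p - q)\<bar> \<le> (p - q)\<^sup>2 / (4 * \<mu>)"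
proof -
  have *: "x * ln (1 / \<mu>) - (x - \<mu>) - (x - \<mu>)\<^sup>2 / \<mu> \<le> plogp x \<and>
      plogp x \<le> x * ln (1 / \<mu>) - (x - \<mu>)" if "0 \<le> x" for x
  proof (cases "x = 0")
    case True
    then show ?thesis using assms(4) by (simp add: plogp_def power2_eq_square)
  next
    case False
    with that have x: "0 < x" by simp
    have "ln (x / \<mu>) \<le> x / \<mu> - 1" using x assms(4) by (intro ln_le_minus_one) simp
    then have "x * ln (x / \<mu>) \<le> x * (x / \<mu> - 1)" using x by (intro mult_left_mono) auto
    also have "\<dots> = (x - \<mu>) + (x - \<mu>)\<^sup>2 / \<mu>"
      using assms(4) by (simp add: power2_eq_square field_simps)
    finally have up: "x * ln (x / \<mu>) \<le> (x - \<mu>) + (x - \<mu>)\<^sup>2 / \<mu>" .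
    have "ln (\<mu> / x) \<le> \<mu> / x - 1" using x assms(4) by (intro ln_le_minus_one) simp
    then have "x * ln (\<mu> / x) \<le> x * (\<mu> / x - 1)" using x by (intro mult_left_mono) auto
    also have "\<dots> = \<mu> - x" using x by (simp add: field_simps)
    finally have lo: "x * ln (\<mu> / x) \<le> \<mu> - x" .
    have "plogp x = x * ln (1 / \<mu>) - x * ln (x / \<mu>)" "x * ln (\<mu> / x) = - (x * ln (x / \<mu>))"
      using x assms(4) by (simp_all add: plogp_def ln_div algebra_simps)
    with up lo show ?thesis by linarith
  qed
  have e: "p - \<mu> = (p - q) / 2" "q - \<mu> = - ((p - q) / 2)" using assms(3) by (simp_all add: field_simps)
  have e2: "(p - \<mu>)\<^sup>2 / \<mu> = (p - q)\<^sup>2 / (4 * \<mu>)" "(q - \<mu>)\<^sup>2 / \<mu> = (p - q)\<^sup>2 / (4 * \<mu>)"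
    unfolding e by (simp_all add: power_divide power2_commute)
  have "(p - q) * ln (1 / \<mu>) = p * ln (1 / \<mu>) - q * ln (1 / \<mu>)" by (simp add: algebra_simps)
  with *[OF assms(1)] *[OF assms(2)] e show ?thesis unfolding e2 by linarith
qed

text \<open>Modulus of continuity of \<open>plogp\<close> with the logarithm capped by a free cutoff
  \<open>\<theta>\<close>. The result is linear in \<open>|p - q|\<close>, so Cauchy-Schwarz applies
  to its sum.\<close>

lemma plogp_diff_le:
  fixes p q \<theta> :: real
  assumes "0 \<le> p" "p \<le> 1" "0 \<le> q" "q \<le> 1" "0 < \<theta>" "1 \<le> ln (1 / \<theta>)"
  shows "\<bar>plogp p - plogp q\<bar> \<le> (\<bar>p - q\<bar> + \<theta>) * ln (1 / \<theta>)"
proof -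
  have *: "\<bar>plogp p - plogp q\<bar> \<le> (p - q + \<theta>) * ln (1 / \<theta>)" if "0 \<le> q" "q < p" "p \<le> 1" for p q
  proof -
    define t where "t = p - q"
    have t: "0 < t" "t \<le> p" "p \<le> 1" using that by (simp_all add: t_def)
    have pos: "0 \<le> ln (1 / p)" using t by simp
    have "plogp q - plogp p \<le> t"
    proof (cases "q = 0")
      case True
      have "0 \<le> p * ln (1 / p)" using t pos by (intro mult_nonneg_nonneg) auto
      then have "0 \<le> plogp p" by (simp only: plogp_def)
      moreover have "plogp q = 0" using True by (simp add: plogp_def)
      ultimately show ?thesis using t by linarith
    next
      case False
      with that have q: "0 < q" by simp
      have "q * ln (p / q) \<le> q * (p / q - 1)"
        using q that by (intro mult_left_mono ln_le_minus_one) auto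
      also have "\<dots> = t" using q by (simp add: t_def field_simps)
      finally have "q * ln (p / q) \<le> t" .
      moreover have "q * ln (1 / q) = q * ln (1 / p) + q * ln (p / q)"
        using q that by (simp add: ln_div algebra_simps)
      moreover have "q * ln (1 / p) \<le> p * ln (1 / p)"
        using pos that by (intro mult_right_mono) auto
      ultimately show ?thesis by (simp add: plogp_def)
    qed
    moreover have "t * 1 \<le> (t + \<theta>) * ln (1 / \<theta>)"
      using t assms by (intro mult_mono) auto
    \<comment> \<open>Subadditivity: \<open>plogp (q + t) \<le> plogp q + plogp t\<close>.\<close>
    moreover have "plogp p - plogp q \<le> t * ln (1 / t)"
    proof -
      have "plogp p - plogp q \<le> t * ln (1 / p)"
      proof (cases "q = 0")
        case True
        then show ?thesis by (simp add: plogp_def t_def)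
      next
        case False
        with that have "q * ln (1 / p) \<le> q * ln (1 / q)"
          by (intro mult_left_mono) (auto simp: ln_div)
        then show ?thesis by (simp add: plogp_def t_def algebra_simps)
      qed
      also have "\<dots> \<le> t * ln (1 / t)" using t by (intro mult_left_mono) (auto simp: ln_div)
      finally show ?thesis .
    qed
    moreover have "t * ln (1 / t) \<le> (t + \<theta>) * ln (1 / \<theta>)"
    proof (cases "t \<ge> \<theta>")
      case True
      then show ?thesis using t assms by (intro mult_mono) (auto simp: ln_div)
    next
      case False
      \<comment> \<open>\<open>ln (1 / t) = ln (1 / \<theta>) + ln (\<theta> / t)\<close>, and
        \<open>t\<close> times the last logarithm costs at most \<open>\<theta>\<close>.\<close>
      have "t * ln (\<theta> / t) \<le> t * (\<theta> / t - 1)"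
        using t assms by (intro mult_left_mono ln_le_minus_one) auto
      also have "\<dots> \<le> \<theta> * 1" using t by (simp add: field_simps)
      also have "\<dots> \<le> \<theta> * ln (1 / \<theta>)" using assms by (intro mult_left_mono) auto
      finally show ?thesis using t assms by (simp add: ln_div algebra_simps)
    qed
    ultimately have "\<bar>plogp p - plogp q\<bar> \<le> (t + \<theta>) * ln (1 / \<theta>)" by linarith
    then show ?thesis by (simp only: t_def)
  qed
  consider "q < p" | "p < q" | "p = q" by linarith
  then show ?thesis
  proof cases
    case 1
    then show ?thesis using *[of q p] assms by simp
  next
    case 2
    then show ?thesis using *[of p q] assms by (simp add: abs_minus_commute)
  next
    case 3
    have "0 \<le> \<theta> * ln (1 / \<theta>)" using assms by (intro mult_nonneg_nonneg) linarith+
    with 3 show ?thesis by (simp del: ln_divide_pos)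
  qed
qed

lemma sum_abs_le_sqrt:
  fixes a b :: "nat \<Rightarrow> real"
  assumes "finite S"
  shows "(\<Sum>i\<in>S. \<bar>a i * b i\<bar>) \<le> sqrt ((\<Sum>i\<in>S. (a i)\<^sup>2) * (\<Sum>i\<in>S. (b i)\<^sup>2))"
proof -
  have "(\<Sum>i\<in>S. \<bar>a i\<bar> * \<bar>b i\<bar>)\<^sup>2 \<le> (\<Sum>i\<in>S. \<bar>a i\<bar>\<^sup>2) * (\<Sum>i\<in>S. \<bar>b i\<bar>\<^sup>2)"
    by (rule Cauchy_Schwarz_ineq_sum)
  then show ?thesis by (intro real_le_rsqrt) (simp add: abs_mult)
qed

text \<open>A deterministic statement: the quality of the counts enters through \<open>Y\<close> and
  \<open>c i \<le> m\<close> alone. Elements are split at \<open>lam i = 1\<close>. Since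
  \<open>1 + lam i\<close> is at most 2 below the split and at most \<open>2 * lam i\<close> above
  it, the single norm \<open>D\<close> serves both sides. The four summands stem from the
  second-order error on heavy elements, their logarithms, the light elements, and the
  cutoff.\<close>

lemma entropy_diff_bound:
  fixes p q :: "nat \<Rightarrow> real" and c :: "nat \<Rightarrow> nat" and m n :: nat
  assumes p: "\<And>i. 0 \<le> p i" "\<And>i. p i \<le> 1" "(\<Sum>i=1..n. p i) = 1"
    and q: "\<And>i. 0 \<le> q i" "\<And>i. q i \<le> 1" "(\<Sum>i=1..n. q i) = 1"
    and m: "1 \<le> m" and c: "\<And>i. c i \<le> m"
    and lam: "\<And>i. lam i = real m * ((p i + q i) / 2)"
    and D: "D = (\<Sum>i=1..n. (p i - q i)\<^sup>2 / (1 + lam i))"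
    and Y: "Y = (\<Sum>i\<in>{i\<in>{1..n}. 1 \<le> lam i}. (1 + lam i) * (ln ((1 + real (c i)) / lam i))\<^sup>2)"
    and l: "l = ln (real m + 1)"
  shows "\<bar>(\<Sum>i=1..n. plogp (p i)) - (\<Sum>i=1..n. plogp (q i))
      + (\<Sum>i=1..n. (p i - q i) * ln (1 + real (c i)))\<bar>
    \<le> real m / 2 * D + sqrt (D * Y) + sqrt (2 * real n * D) * (1 + 3 * l)
      + real n * (2 * l) / (real m + 1)\<^sup>2"
proof -
  define d where "d i = p i - q i" for i
  define F where "F i = ln (1 + real (c i)) - ln (real m)" for i
  define Hv where "Hv = {i\<in>{1..n}. 1 \<le> lam i}"
  define Lt where "Lt = {i\<in>{1..n}. lam i < 1}"
  \<comment> \<open>This cutoff makes \<open>ln (1 / \<theta>)\<close> equal to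
    \<open>2 * l\<close>, and its total cost is below a multiple of \<open>n^(3/4) * l / m\<close>
    once \<open>m \<ge> n^(3/4)\<close>.\<close>
  define \<theta> where "\<theta> = 1 / (real m + 1)\<^sup>2"
  have lam0: "0 \<le> lam i" for i using p q by (simp add: lam)
  have split: "(\<Sum>i=1..n. g i) = (\<Sum>i\<in>Hv. g i) + (\<Sum>i\<in>Lt. g i)" for g :: "nat \<Rightarrow> real"
  proof -
    have "{1..n} = Hv \<union> Lt" "Hv \<inter> Lt = {}" "finite Hv" "finite Lt"
      by (auto simp: Hv_def Lt_def)
    then show ?thesis by (metis sum.union_disjoint)
  qed
  have sub: "(\<Sum>i\<in>S. g i) \<le> (\<Sum>i=1..n. g i)"
    if "S \<subseteq> {1..n}" "\<And>i. 0 \<le> g i" for g :: "nat \<Rightarrow> real" and S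
    using that by (intro sum_mono2) auto
  have Dnn: "0 \<le> D" unfolding D using lam0 by (intro sum_nonneg divide_nonneg_pos) (auto simp: add_pos_nonneg)
  have tm: "0 \<le> (p i - q i)\<^sup>2 / (1 + lam i)" for i
    using lam0[of i] by (intro divide_nonneg_nonneg) auto
  have \<theta>0: "0 < \<theta>" by (simp add: \<theta>_def add_nonneg_pos)
  have l2: "ln (1 / \<theta>) = 2 * l"
    using m by (simp add: \<theta>_def l ln_realpow)
  have l1: "1 \<le> 2 * l"
  proof -
    have "ln 2 \<le> l" unfolding l using m by simp
    then show ?thesis using ln2_ge_two_thirds by linarith
  qed
  have Fl: "\<bar>F i\<bar> \<le> l" for i
  proof -
    have "ln (1 + real (c i)) \<le> l" unfolding l using c[of i] by simp
    moreover have "0 \<le> ln (1 + real (c i))" "0 \<le> ln (real m)" "ln (real m) \<le> l"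
      using m by (simp_all add: l)
    ultimately show ?thesis unfolding F_def by linarith
  qed
  have light: "(\<Sum>i\<in>Lt. \<bar>d i\<bar>) \<le> sqrt (2 * real n * D)"
  proof -
    have "(\<Sum>i\<in>Lt. \<bar>d i * 1\<bar>) \<le> sqrt ((\<Sum>i\<in>Lt. (d i)\<^sup>2) * (\<Sum>i\<in>Lt. 1\<^sup>2))"
      by (rule sum_abs_le_sqrt) (simp add: Lt_def)
    also have "\<dots> \<le> sqrt ((2 * D) * real n)"
    proof (intro real_sqrt_le_mono mult_mono)
      have "(\<Sum>i\<in>Lt. (d i)\<^sup>2) \<le> (\<Sum>i\<in>Lt. 2 * ((p i - q i)\<^sup>2 / (1 + lam i)))"
      proof (rule sum_mono)
        fix i assume "i \<in> Lt"
        then have "lam i < 1" by (simp add: Lt_def)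
        then have "(d i)\<^sup>2 * (1 + lam i) \<le> (d i)\<^sup>2 * 2" by (intro mult_left_mono) auto
        then show "(d i)\<^sup>2 \<le> 2 * ((p i - q i)\<^sup>2 / (1 + lam i))"
          using lam0[of i] by (simp add: d_def field_simps)
      qed
      also have "\<dots> \<le> 2 * D"
        unfolding sum_distrib_left[symmetric] D
        by (intro mult_left_mono sub tm) (auto simp: Lt_def)
      finally show "(\<Sum>i\<in>Lt. (d i)\<^sup>2) \<le> 2 * D" .
      have "card Lt \<le> card {1..n}" unfolding Lt_def by (intro card_mono) auto
      then show "(\<Sum>i\<in>Lt. 1\<^sup>2) \<le> real n" by simp
    qed (use Dnn in \<open>auto intro: sum_nonneg\<close>)
    finally show ?thesis by (simp add: mult_ac)
  qed
  let ?r = "\<lambda>i. plogp (p i) - plogp (q i) + d i * F i"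
  have "(\<Sum>i=1..n. d i) = 0" using p q by (simp add: d_def sum_subtractf)
  then have d0: "(\<Sum>i\<in>Hv. d i) = - (\<Sum>i\<in>Lt. d i)" using split[of d] by simp
  \<comment> \<open>The differences sum to zero, so the unknown scale \<open>ln m\<close> in the
    logarithms of the counts is free.\<close>
  have "(\<Sum>i=1..n. d i * F i) = (\<Sum>i=1..n. d i * ln (1 + real (c i))) - ln (real m) * (\<Sum>i=1..n. d i)"
    by (simp add: F_def right_diff_distrib sum_subtractf sum_distrib_left mult.commute)
  then have lhs: "(\<Sum>i=1..n. plogp (p i)) - (\<Sum>i=1..n. plogp (q i))
      + (\<Sum>i=1..n. (p i - q i) * ln (1 + real (c i))) = (\<Sum>i\<in>Hv. ?r i) + (\<Sum>i\<in>Lt. ?r i)"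
    using \<open>(\<Sum>i=1..n. d i) = 0\<close> unfolding split[symmetric]
    by (simp add: sum.distrib sum_subtractf d_def)
  \<comment> \<open>Per light element, \<open>2 * l\<close> comes from the modulus of continuity and
    \<open>l\<close> from \<open>F i\<close>, hence \<open>3 * l\<close>.\<close>
  have "\<bar>\<Sum>i\<in>Lt. ?r i\<bar> \<le> (\<Sum>i\<in>Lt. \<bar>d i\<bar> * (3 * l) + \<theta> * (2 * l))"
  proof (intro order_trans[OF sum_abs] sum_mono)
    fix i
    have "\<bar>plogp (p i) - plogp (q i)\<bar> \<le> (\<bar>d i\<bar> + \<theta>) * (2 * l)"
      unfolding d_def by (rule plogp_diff_le[OF p(1) p(2) q(1) q(2) \<theta>0, unfolded l2, OF l1])
    moreover have "\<bar>d i * F i\<bar> \<le> \<bar>d i\<bar> * l"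
      unfolding abs_mult using Fl by (intro mult_left_mono) auto
    ultimately show "\<bar>?r i\<bar> \<le> \<bar>d i\<bar> * (3 * l) + \<theta> * (2 * l)"
      by (simp add: algebra_simps)
  qed
  also have "\<dots> = (\<Sum>i\<in>Lt. \<bar>d i\<bar>) * (3 * l) + real (card Lt) * (\<theta> * (2 * l))"
    by (simp add: sum.distrib sum_distrib_right)
  also have "\<dots> \<le> (\<Sum>i\<in>Lt. \<bar>d i\<bar>) * (3 * l) + real n * (\<theta> * (2 * l))"
  proof -
    have "card Lt \<le> card {1..n}" unfolding Lt_def by (intro card_mono) auto
    then have "real (card Lt) \<le> real n" by simp
    then show ?thesis using l1 by (intro add_left_mono mult_right_mono) (auto simp: \<theta>_def)
  qed
  finally have L: "\<bar>\<Sum>i\<in>Lt. ?r i\<bar> \<le> (\<Sum>i\<in>Lt. \<bar>d i\<bar>) * (3 * l) + real n * (\<theta> * (2 * l))" .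
  let ?g = "\<lambda>i. ln ((1 + real (c i)) / lam i)"
  \<comment> \<open>Adding \<open>d i\<close> cancels the linear term of the expansion at the mean.
    Over the heavy elements these corrections sum to minus the light differences, which accounts for
    the 1 in \<open>1 + 3 * l\<close>.\<close>
  have "\<bar>\<Sum>i\<in>Hv. ?r i + d i\<bar> \<le> (\<Sum>i\<in>Hv. real m / 2 * ((p i - q i)\<^sup>2 / (1 + lam i)) + \<bar>d i * ?g i\<bar>)"
  proof (intro order_trans[OF sum_abs] sum_mono)
    fix i assume "i \<in> Hv"
    then have li: "1 \<le> lam i" by (simp add: Hv_def)
    let ?\<mu> = "(p i + q i) / 2"
    have mu: "0 < ?\<mu>"
    proof (rule ccontr)
      assume "\<not> 0 < ?\<mu>"
      then have "?\<mu> = 0" using p(1)[of i] q(1)[of i] by simp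
      then show False using li by (simp add: lam)
    qed
    have *: "ln ((1 + real k) / (real m * u)) = ln (1 + real k) - ln (real m) + ln (1 / u)"
      if "0 < u" for k u
      using that m by (simp add: ln_div ln_mult)
    have "F i = ?g i - ln (1 / ?\<mu>)"
      unfolding F_def lam *[OF mu] by simp
    then have "d i * F i = d i * ?g i - d i * ln (1 / ?\<mu>)" by (simp only: right_diff_distrib)
    then have "?r i + d i = (plogp (p i) - plogp (q i) - d i * ln (1 / ?\<mu>) + d i) + d i * ?g i"
      by linarith
    moreover have "\<bar>plogp (p i) - plogp (q i) - d i * ln (1 / ?\<mu>) + d i\<bar> \<le> (d i)\<^sup>2 / (4 * ?\<mu>)"
      unfolding d_def using p q mu by (intro plogp_diff_near_mean) auto
    moreover have "(d i)\<^sup>2 / (4 * ?\<mu>) \<le> real m / 2 * ((p i - q i)\<^sup>2 / (1 + lam i))"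
    proof -
      have "(d i)\<^sup>2 / (4 * u) = real m / 4 * ((d i)\<^sup>2 / (real m * u))" for u
        using m by simp
      from this[of ?\<mu>] have "(d i)\<^sup>2 / (4 * ?\<mu>) = real m / 4 * ((d i)\<^sup>2 / lam i)"
        unfolding lam .
      also have "\<dots> \<le> real m / 4 * (2 * ((d i)\<^sup>2 / (1 + lam i)))"
      proof (intro mult_left_mono)
        have "(d i)\<^sup>2 * (1 + lam i) \<le> (d i)\<^sup>2 * (2 * lam i)"
          using li by (intro mult_left_mono) auto
        then show "(d i)\<^sup>2 / lam i \<le> 2 * ((d i)\<^sup>2 / (1 + lam i))"
          using li by (simp add: field_simps)
      qed auto
      finally show ?thesis by (simp add: d_def)
    qed
    ultimately show "\<bar>?r i + d i\<bar> \<le> real m / 2 * ((p i - q i)\<^sup>2 / (1 + lam i)) + \<bar>d i * ?g i\<bar>"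
      by linarith
  qed
  also have "\<dots> \<le> real m / 2 * D + sqrt (D * Y)"
    unfolding sum.distrib
  proof (rule add_mono)
    show "(\<Sum>i\<in>Hv. real m / 2 * ((p i - q i)\<^sup>2 / (1 + lam i))) \<le> real m / 2 * D"
      unfolding sum_distrib_left[symmetric] D by (intro mult_left_mono sub tm) (auto simp: Hv_def)
    \<comment> \<open>The factors are balanced by \<open>sqrt (1 + lam i)\<close> so that
      Cauchy-Schwarz produces \<open>D\<close> and \<open>Y\<close>.\<close>
    have "(\<Sum>i\<in>Hv. \<bar>d i * ?g i\<bar>) =
        (\<Sum>i\<in>Hv. \<bar>(d i / sqrt (1 + lam i)) * (sqrt (1 + lam i) * ?g i)\<bar>)"
    proof (rule sum.cong[OF refl])
      fix i
      have "sqrt (1 + lam i) \<noteq> 0" using lam0[of i] by simp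
      then have "d i * ?g i = (d i / sqrt (1 + lam i)) * (sqrt (1 + lam i) * ?g i)" by simp
      then show "\<bar>d i * ?g i\<bar> = \<bar>(d i / sqrt (1 + lam i)) * (sqrt (1 + lam i) * ?g i)\<bar>" by metis
    qed
    also have "\<dots> \<le> sqrt ((\<Sum>i\<in>Hv. (d i / sqrt (1 + lam i))\<^sup>2) * (\<Sum>i\<in>Hv. (sqrt (1 + lam i) * ?g i)\<^sup>2))"
      by (rule sum_abs_le_sqrt) (simp add: Hv_def)
    also have "\<dots> = sqrt ((\<Sum>i\<in>Hv. (p i - q i)\<^sup>2 / (1 + lam i)) * Y)"
      unfolding Y Hv_def[symmetric] using lam0 by (simp add: power_divide power_mult_distrib d_def)
    also have "\<dots> \<le> sqrt (D * Y)"
    proof (intro real_sqrt_le_mono mult_right_mono)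
      show "(\<Sum>i\<in>Hv. (p i - q i)\<^sup>2 / (1 + lam i)) \<le> D"
        unfolding D by (intro sub tm) (auto simp: Hv_def)
      show "0 \<le> Y" unfolding Y using lam0 by (intro sum_nonneg mult_nonneg_nonneg) (auto simp: add_nonneg_nonneg)
    qed
    finally show "(\<Sum>i\<in>Hv. \<bar>d i * ?g i\<bar>) \<le> sqrt (D * Y)" .
  qed
  finally have "\<bar>(\<Sum>i\<in>Hv. ?r i) + (\<Sum>i\<in>Hv. d i)\<bar> \<le> real m / 2 * D + sqrt (D * Y)"
    by (simp add: sum.distrib)
  moreover have "\<bar>\<Sum>i\<in>Lt. d i\<bar> \<le> (\<Sum>i\<in>Lt. \<bar>d i\<bar>)" by (rule sum_abs)
  ultimately have "\<bar>(\<Sum>i\<in>Hv. ?r i) + (\<Sum>i\<in>Lt. ?r i)\<bar> \<le> real m / 2 * D + sqrt (D * Y) +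
      (\<Sum>i\<in>Lt. \<bar>d i\<bar>) * (1 + 3 * l) + real n * (\<theta> * (2 * l))"
    using L d0 unfolding distrib_left by linarith
  also have "\<dots> \<le> real m / 2 * D + sqrt (D * Y) + sqrt (2 * real n * D) * (1 + 3 * l)
      + real n * (\<theta> * (2 * l))"
    using light l1 by (intro add_mono mult_right_mono order_refl) auto
  finally show ?thesis unfolding lhs by (simp add: \<theta>_def)
qed

section \<open>The two statistics\<close>

text \<open>Bias-variance decomposition around an arbitrary centre. It is applied conditionally on
  another batch, where the mean of the sum differs from the overall mean.\<close>

lemma iid_sum_centered:
  assumes "finite (set_pmf M)"
  shows "E (replicate_pmf m M) (\<lambda>xs. ((\<Sum>x\<leftarrow>xs. g x) - b)\<^sup>2)
    \<le> real m * E M (\<lambda>x. (g x)\<^sup>2) + (real m * E M g - b)\<^sup>2"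
proof -
  let ?a = "real m * E M g" and ?s = "\<lambda>xs. \<Sum>x\<leftarrow>xs. g x"
  have "E (replicate_pmf m M) (\<lambda>xs. (?s xs - b)\<^sup>2) =
      E (replicate_pmf m M) (\<lambda>xs. (?s xs - ?a)\<^sup>2 + (2 * (?a - b)) * (?s xs) + (b\<^sup>2 - ?a\<^sup>2))"
    by (rule E_cong) (simp add: power2_eq_square algebra_simps)
  also have "\<dots> = E (replicate_pmf m M) (\<lambda>xs. (?s xs - ?a)\<^sup>2) + (2 * (?a - b) * ?a + (b\<^sup>2 - ?a\<^sup>2))"
    using assms by (simp add: E_add iid_sum_mean)
  also have "2 * (?a - b) * ?a + (b\<^sup>2 - ?a\<^sup>2) = (?a - b)\<^sup>2"
    by (simp add: power2_eq_square algebra_simps)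
  finally show ?thesis using iid_sum_variance[OF assms, of m g] by linarith
qed

section \<open>The abstract tester and its statistics\<close>

definition mix :: "'a pmf \<Rightarrow> 'a pmf \<Rightarrow> 'a pmf" where
  "mix p q = bernoulli_pmf (1/2) \<bind> (\<lambda>b. if b then p else q)"

lemma pmf_mix: "pmf (mix p q) i = (pmf p i + pmf q i) / 2"
  by (simp add: mix_def pmf_bind)

lemma set_pmf_mix: "set_pmf (mix p q) = set_pmf p \<union> set_pmf q"
  by (auto simp: mix_def split: if_splits)

definition diff :: "('a \<Rightarrow> real) \<Rightarrow> 'a \<times> 'a \<Rightarrow> real" where
  "diff g v = g (fst v) - g (snd v)"

definition signed :: "'a \<times> 'a \<Rightarrow> 'a \<Rightarrow> real" where
  "signed u i = of_bool (fst u = i) - of_bool (snd u = i)"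

definition weight :: "'a list \<Rightarrow> 'a \<Rightarrow> real" where
  "weight xs i = 1 / (1 + real (count_list xs i))"

definition log_count :: "'a list \<Rightarrow> 'a \<Rightarrow> real" where
  "log_count xs i = ln (1 + real (count_list xs i))"

text \<open>With \<open>U i\<close> and \<open>V i\<close> the signed counts of the two batches,
  this is the bilinear form \<open>SUM i. weight xs i * U i * V i\<close>, arranged so that each
  sample of the last batch is processed in constant time.\<close>

definition l2_stat :: "'a list \<Rightarrow> ('a \<times> 'a) list \<Rightarrow> ('a \<times> 'a) list \<Rightarrow> real" where
  "l2_stat xs us vs = (\<Sum>v\<leftarrow>vs. diff (\<lambda>i. weight xs i * (\<Sum>u\<leftarrow>us. signed u i)) v)"

definition log_stat :: "'a list \<Rightarrow> ('a \<times> 'a) list \<Rightarrow> real" where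
  "log_stat xs vs = (\<Sum>v\<leftarrow>vs. diff (log_count xs) v)"

text \<open>The tests are squared because the machine has neither roots nor absolute values.
  \<open>640 * n\<close> is 40 times the variance bound \<open>16 * n\<close> for equal
  distributions; \<open>m * \<epsilon> / 4\<close> is half of the mean that an entropy gap forces
  when the norm is small.\<close>

definition verdict :: "nat \<Rightarrow> real \<Rightarrow> nat \<Rightarrow> 'a list \<Rightarrow> ('a \<times> 'a) list \<Rightarrow> ('a \<times> 'a) list \<Rightarrow> bool" where
  "verdict n \<epsilon> m xs us vs \<longleftrightarrow>
    (l2_stat xs us vs)\<^sup>2 \<le> 640 * real n \<and> (log_stat xs vs)\<^sup>2 \<le> (real m * \<epsilon> / 4)\<^sup>2"

definition tester :: "nat \<Rightarrow> real \<Rightarrow> nat \<Rightarrow> 'a pmf \<Rightarrow> 'a pmf \<Rightarrow> bool pmf" where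
  "tester n \<epsilon> m p q =
    replicate_pmf m (mix p q) \<bind> (\<lambda>xs.
    replicate_pmf m (pair_pmf p q) \<bind> (\<lambda>us.
    replicate_pmf m (pair_pmf p q) \<bind> (\<lambda>vs. return_pmf (verdict n \<epsilon> m xs us vs))))"

lemma weight_pos [simp]: "0 < weight xs i"
  and weight_nonneg [simp]: "0 \<le> weight xs i"
  and weight_le_1 [simp]: "weight xs i \<le> 1"
  by (simp_all add: weight_def add_pos_nonneg)

locale two_sources =
  fixes n m :: nat and p q :: "nat pmf"
  assumes n: "1 \<le> n" and m: "1 \<le> m"
    and supp_p: "set_pmf p \<subseteq> {1..n}" and supp_q: "set_pmf q \<subseteq> {1..n}"
begin

definition d :: "nat \<Rightarrow> real" where "d i = pmf p i - pmf q i"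
definition \<mu> :: "nat \<Rightarrow> real" where "\<mu> i = (pmf p i + pmf q i) / 2"
definition lam :: "nat \<Rightarrow> real" where "lam i = real m * \<mu> i"
definition D :: real where "D = (\<Sum>i=1..n. (d i)\<^sup>2 / (1 + lam i))"
definition PQ :: "(nat \<times> nat) pmf" where "PQ = pair_pmf p q"
definition Xs :: "nat list pmf" where "Xs = replicate_pmf m (mix p q)"
definition Us :: "(nat \<times> nat) list pmf" where "Us = replicate_pmf m PQ"

lemma fin [simp]: "finite (set_pmf p)" "finite (set_pmf q)"
  using supp_p supp_q finite_subset by blast+

lemma fin_mix: "finite (set_pmf (mix p q))" by (simp add: set_pmf_mix)
lemma fin_PQ [simp]: "finite (set_pmf PQ)" by (simp add: PQ_def)
lemma fin_Xs [simp]: "finite (set_pmf Xs)" unfolding Xs_def by (intro finite_replicate_pmf fin_mix)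
lemma fin_Us [simp]: "finite (set_pmf Us)" unfolding Us_def by simp

lemma \<mu>_nonneg: "0 \<le> \<mu> i" by (simp add: \<mu>_def)
lemma lam_nonneg: "0 \<le> lam i" by (simp add: lam_def \<mu>_nonneg)
lemma D_nonneg: "0 \<le> D"
  unfolding D_def using lam_nonneg by (intro sum_nonneg divide_nonneg_nonneg) (auto simp: add_nonneg_nonneg)

lemma E_p: "E p g = (\<Sum>i=1..n. pmf p i * g i)" and E_q: "E q g = (\<Sum>i=1..n. pmf q i * g i)"
  using supp_p supp_q by (subst integral_measure_pmf[of "{1..n}"]; auto)+

lemma E_diff_PQ: "E PQ (diff g) = (\<Sum>i=1..n. d i * g i)"
proof -
  have "E PQ (diff g) = E p g - E q g"
    unfolding PQ_def diff_def by (simp add: E_pair E_diff)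
  then show ?thesis by (simp add: E_p E_q d_def left_diff_distrib sum_subtractf)
qed

lemma E_add_PQ: "E PQ (\<lambda>v. g (fst v) + g (snd v)) = 2 * (\<Sum>i=1..n. \<mu> i * g i)"
proof -
  have "E PQ (\<lambda>v. g (fst v) + g (snd v)) = E p g + E q g"
    unfolding PQ_def by (simp add: E_pair E_add)
  also have "\<dots> = (\<Sum>i=1..n. 2 * (\<mu> i * g i))"
    unfolding E_p E_q sum.distrib[symmetric] by (rule sum.cong) (auto simp: \<mu>_def field_simps)
  finally show ?thesis by (simp add: sum_distrib_left)
qed

lemma E_diff_square: "E PQ (\<lambda>v. (diff g v)\<^sup>2) \<le> 4 * (\<Sum>i=1..n. \<mu> i * (g i)\<^sup>2)"
proof -
  have "(diff g v)\<^sup>2 \<le> 2 * (g (fst v))\<^sup>2 + 2 * (g (snd v))\<^sup>2" for v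
    using zero_le_power2[of "g (fst v) + g (snd v)"]
    by (simp add: diff_def power2_diff power2_sum)
  then have "E PQ (\<lambda>v. (diff g v)\<^sup>2) \<le> E PQ (\<lambda>v. 2 * (g (fst v))\<^sup>2 + 2 * (g (snd v))\<^sup>2)"
    by (intro E_mono) auto
  also have "\<dots> = 2 * (\<Sum>i=1..n. \<mu> i * (2 * (g i)\<^sup>2))"
    by (rule E_add_PQ)
  finally show ?thesis by (simp add: sum_distrib_left mult_ac)
qed

lemma E_signed: "E PQ (\<lambda>u. signed u i) = d i"
proof -
  have [simp]: "E r (\<lambda>x. of_bool (x = i)) = pmf r i" for r
  proof -
    have "(\<lambda>x. of_bool (x = i)) = indicat_real {i}" by (auto simp: indicator_def)
    then show ?thesis by (simp add: measure_pmf_single)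
  qed
  show ?thesis unfolding PQ_def signed_def by (simp add: E_pair E_diff d_def)
qed

lemma E_signed_square: "E PQ (\<lambda>u. (signed u i)\<^sup>2) \<le> 2 * \<mu> i"
proof -
  have [simp]: "E r (\<lambda>x. of_bool (x = i)) = pmf r i" for r
  proof -
    have "(\<lambda>x. of_bool (x = i)) = indicat_real {i}" by (auto simp: indicator_def)
    then show ?thesis by (simp add: measure_pmf_single)
  qed
  have "E PQ (\<lambda>u. (signed u i)\<^sup>2) \<le> E PQ (\<lambda>u. of_bool (fst u = i) + of_bool (snd u = i))"
    by (intro E_mono) (auto simp: signed_def)
  also have "\<dots> = 2 * \<mu> i"
    unfolding PQ_def by (simp add: E_pair E_add \<mu>_def)
  finally show ?thesis .
qed

text \<open>The statistic is a double sum of a kernel \<open>K u v\<close> whose conditional means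
  in either argument are the same function \<open>g\<close>. Conditioning on \<open>us\<close>
  separates the fluctuation over \<open>vs\<close> from that of the conditional mean. With
  \<open>A\<close> and \<open>B\<close> the second moments of \<open>K\<close> and \<open>g\<close>,
  the total is at most \<open>m^2 * A + 2 * m^3 * B\<close>.\<close>

lemma l2_stat_variance:
  "E Us (\<lambda>us. E Us (\<lambda>vs. (l2_stat xs us vs - (real m)\<^sup>2 * (\<Sum>i=1..n. weight xs i * (d i)\<^sup>2))\<^sup>2))
   \<le> 8 * (real m)\<^sup>2 * (\<Sum>i=1..n. (weight xs i)\<^sup>2 * (\<mu> i)\<^sup>2)
     + 8 * (real m)^3 * (\<Sum>i=1..n. (weight xs i)\<^sup>2 * \<mu> i * (d i)\<^sup>2)"
proof -
  let ?w = "weight xs"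
  define \<sigma> where "\<sigma> = (\<Sum>i=1..n. ?w i * (d i)\<^sup>2)"
  define K where "K u v = diff (\<lambda>i. ?w i * signed u i) v" for u v
  define g where "g = diff (\<lambda>i. ?w i * d i)"
  define B where "B = E PQ (\<lambda>v. (g v)\<^sup>2)"
  define A where "A = E PQ (\<lambda>v. E PQ (\<lambda>u. (K u v)\<^sup>2))"
  have lin: "diff (\<lambda>i. ?w i * (\<Sum>u\<leftarrow>us. signed u i)) v = (\<Sum>u\<leftarrow>us. K u v)" for us v
    by (induction us) (simp_all add: diff_def K_def algebra_simps)
  have EvK: "E PQ (K u) = g u" for u
  proof -
    have "E PQ (K u) = (\<Sum>i=1..n. (d i * ?w i) * signed u i)"
      unfolding K_def by (simp add: E_diff_PQ mult_ac)
    also have "\<dots> = g u"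
    proof -
      \<comment> \<open>Outside \<open>{1..n}\<close> both sides vanish, because
        \<open>d x = 0\<close> there.\<close>
      have pt: "(\<Sum>i=1..n. (d i * ?w i) * of_bool (x = i)) = d x * ?w x" for x
      proof (cases "x \<in> {1..n}")
        case False
        then have "x \<notin> set_pmf p" "x \<notin> set_pmf q" using supp_p supp_q by blast+
        then have "d x = 0" by (simp add: d_def set_pmf_iff)
        with False show ?thesis by (intro trans[OF sum.neutral]) auto
      qed simp
      show ?thesis
        unfolding signed_def right_diff_distrib sum_subtractf pt by (simp add: g_def diff_def)
    qed
    finally show ?thesis .
  qed
  have EuK: "E PQ (\<lambda>u. K u v) = g v" for v
    unfolding K_def diff_def g_def by (simp add: E_diff E_signed)
  have mean: "E PQ (diff (\<lambda>i. ?w i * (\<Sum>u\<leftarrow>us. signed u i))) = (\<Sum>u\<leftarrow>us. g u)" for us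
  proof -
    have "E PQ (\<lambda>v. \<Sum>u\<leftarrow>us. K u v) = (\<Sum>u\<leftarrow>us. g u)"
      by (induction us) (simp_all add: E_add EvK)
    moreover have "diff (\<lambda>i. ?w i * (\<Sum>u\<leftarrow>us. signed u i)) = (\<lambda>v. \<Sum>u\<leftarrow>us. K u v)"
      using lin by (rule ext)
    ultimately show ?thesis by simp
  qed
  have Eg: "E PQ g = \<sigma>"
    unfolding g_def E_diff_PQ \<sigma>_def by (simp add: power2_eq_square mult_ac)
  \<comment> \<open>The centre is the mean over both batches, so given \<open>us\<close> a squared
    bias appears as second summand.\<close>
  have "E Us (\<lambda>us. E Us (\<lambda>vs. (l2_stat xs us vs - (real m)\<^sup>2 * \<sigma>)\<^sup>2)) \<le>
     E Us (\<lambda>us. real m * E PQ (\<lambda>v. (\<Sum>u\<leftarrow>us. K u v)\<^sup>2) + (real m * (\<Sum>u\<leftarrow>us. g u) - (real m)\<^sup>2 * \<sigma>)\<^sup>2)"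
    by (rule E_mono, simp)
      (simp only: Us_def l2_stat_def mean[symmetric] lin[symmetric], rule iid_sum_centered, simp)
  also have "\<dots> = real m * E Us (\<lambda>us. E PQ (\<lambda>v. (\<Sum>u\<leftarrow>us. K u v)\<^sup>2)) +
      (real m)\<^sup>2 * E Us (\<lambda>us. ((\<Sum>u\<leftarrow>us. g u) - real m * \<sigma>)\<^sup>2)"
  proof -
    have "(real m * s - (real m)\<^sup>2 * \<sigma>)\<^sup>2 = (real m)\<^sup>2 * (s - real m * \<sigma>)\<^sup>2" for s
      by (simp add: power2_eq_square algebra_simps)
    then show ?thesis by (simp add: E_add)
  qed
  also have "\<dots> \<le> real m * (real m * A + (real m)\<^sup>2 * B) + (real m)\<^sup>2 * (real m * B)"
  proof (intro add_mono mult_left_mono)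
    have "E Us (\<lambda>us. E PQ (\<lambda>v. (\<Sum>u\<leftarrow>us. K u v)\<^sup>2)) = E PQ (\<lambda>v. E Us (\<lambda>us. (\<Sum>u\<leftarrow>us. K u v)\<^sup>2))"
      by (rule E_pair_swap) auto
    also have "\<dots> = E PQ (\<lambda>v. real m * E PQ (\<lambda>u. (K u v)\<^sup>2) + real m * (real m - 1) * (g v)\<^sup>2)"
      unfolding Us_def by (simp add: iid_sum_square EuK)
    also have "\<dots> = real m * A + real m * (real m - 1) * B"
      by (simp add: E_add A_def B_def)
    also have "\<dots> \<le> real m * A + (real m)\<^sup>2 * B"
      unfolding power2_eq_square B_def
      by (intro add_left_mono mult_right_mono E_nonneg) (auto intro: mult_left_mono)
    finally show "E Us (\<lambda>us. E PQ (\<lambda>v. (\<Sum>u\<leftarrow>us. K u v)\<^sup>2)) \<le> real m * A + (real m)\<^sup>2 * B" .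
    show "E Us (\<lambda>us. ((\<Sum>u\<leftarrow>us. g u) - real m * \<sigma>)\<^sup>2) \<le> real m * B"
      unfolding Us_def B_def Eg[symmetric] by (rule iid_sum_variance) simp
  qed auto
  also have "\<dots> = (real m)\<^sup>2 * A + 2 * (real m)^3 * B"
    by (simp add: power2_eq_square power3_eq_cube algebra_simps)
  also have "\<dots> \<le> (real m)\<^sup>2 * (8 * (\<Sum>i=1..n. (?w i)\<^sup>2 * (\<mu> i)\<^sup>2)) +
      2 * (real m)^3 * (4 * (\<Sum>i=1..n. (?w i)\<^sup>2 * \<mu> i * (d i)\<^sup>2))"
  proof (intro add_mono mult_left_mono)
    have "A = E PQ (\<lambda>u. E PQ (\<lambda>v. (K u v)\<^sup>2))"
      unfolding A_def by (rule E_pair_swap) auto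
    also have "\<dots> \<le> E PQ (\<lambda>u. 4 * (\<Sum>i=1..n. \<mu> i * (?w i * signed u i)\<^sup>2))"
      unfolding K_def by (intro E_mono E_diff_square) auto
    also have "\<dots> = (\<Sum>i=1..n. 4 * \<mu> i * (?w i)\<^sup>2 * E PQ (\<lambda>u. (signed u i)\<^sup>2))"
      by (simp add: E_sum sum_distrib_left power_mult_distrib mult_ac)
    also have "\<dots> \<le> (\<Sum>i=1..n. 4 * \<mu> i * (?w i)\<^sup>2 * (2 * \<mu> i))"
      using \<mu>_nonneg by (intro sum_mono mult_left_mono E_signed_square) auto
    also have "\<dots> = 8 * (\<Sum>i=1..n. (?w i)\<^sup>2 * (\<mu> i)\<^sup>2)"
      by (simp add: sum_distrib_left power2_eq_square mult_ac)
    finally show "A \<le> 8 * (\<Sum>i=1..n. (?w i)\<^sup>2 * (\<mu> i)\<^sup>2)" .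
    have "B \<le> 4 * (\<Sum>i=1..n. \<mu> i * (?w i * d i)\<^sup>2)"
      unfolding B_def g_def by (rule E_diff_square)
    then show "B \<le> 4 * (\<Sum>i=1..n. (?w i)\<^sup>2 * \<mu> i * (d i)\<^sup>2)"
      by (simp add: power_mult_distrib mult_ac)
  qed auto
  finally show ?thesis by (simp add: \<sigma>_def mult_ac)
qed

section \<open>Moments of the random weights\<close>

lemma E_weight: "lam i * E Xs (\<lambda>xs. weight xs i) \<le> 1"
proof -
  have "lam i * E Xs (\<lambda>xs. weight xs i) \<le> real (Suc m) * \<mu> i * E Xs (\<lambda>xs. weight xs i)"
    unfolding lam_def using \<mu>_nonneg
    by (intro mult_right_mono E_nonneg) auto
  also have "\<dots> \<le> 1"
    using E_inverse_count[OF fin_mix, of m i] by (simp add: Xs_def weight_def \<mu>_def pmf_mix)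
  finally show ?thesis .
qed

lemma E_weight_square: "(lam i)\<^sup>2 * E Xs (\<lambda>xs. (weight xs i)\<^sup>2) \<le> 2"
proof -
  have "real m * real m * (\<mu> i)\<^sup>2 * E Xs (\<lambda>xs. (weight xs i)\<^sup>2) \<le>
      real (Suc m) * real (Suc (Suc m)) * (\<mu> i)\<^sup>2 * E Xs (\<lambda>xs. (weight xs i)\<^sup>2)"
    by (intro mult_right_mono mult_mono E_nonneg) auto
  also have "\<dots> \<le> 2"
    using E_inverse_count_square[OF fin_mix, of m i] by (simp add: Xs_def weight_def \<mu>_def pmf_mix)
  finally show ?thesis by (simp add: lam_def power2_eq_square mult_ac)
qed

lemma E_weight_square_le_1: "E Xs (\<lambda>xs. (weight xs i)\<^sup>2) \<le> 1"
proof -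
  have "E Xs (\<lambda>xs. (weight xs i)\<^sup>2) \<le> E Xs (\<lambda>_. 1)"
    by (intro E_mono power_le_one) auto
  then show ?thesis by simp
qed

lemma E_one_plus_count: "E Xs (\<lambda>xs. 1 + real (count_list xs i)) = 1 + lam i"
  unfolding E_add[OF fin_Xs] unfolding Xs_def E_count[OF fin_mix] by (simp add: lam_def \<mu>_def pmf_mix)

text \<open>In second moment a weight is at most of order \<open>1 / lam i\<close>, so each element
  adds a constant to the noise, however the mass is spread; this is the purpose of weighting. The
  other part is proportional to \<open>m^2 * D\<close>, hence small against the squared signal once
  the signal is large.\<close>

lemma l2_stat_total_variance:
  "E Xs (\<lambda>xs. E Us (\<lambda>us. E Us (\<lambda>vs.
     (l2_stat xs us vs - (real m)\<^sup>2 * (\<Sum>i=1..n. weight xs i * (d i)\<^sup>2))\<^sup>2)))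
   \<le> 16 * real n + 32 * ((real m)\<^sup>2 * D)"
proof -
  let ?W = "\<lambda>i. E Xs (\<lambda>xs. (weight xs i)\<^sup>2)"
  have W0: "0 \<le> ?W i" for i by (rule E_nonneg) simp
  have "E Xs (\<lambda>xs. E Us (\<lambda>us. E Us (\<lambda>vs.
     (l2_stat xs us vs - (real m)\<^sup>2 * (\<Sum>i=1..n. weight xs i * (d i)\<^sup>2))\<^sup>2)))
   \<le> E Xs (\<lambda>xs. 8 * (real m)\<^sup>2 * (\<Sum>i=1..n. (weight xs i)\<^sup>2 * (\<mu> i)\<^sup>2)
     + 8 * (real m)^3 * (\<Sum>i=1..n. (weight xs i)\<^sup>2 * \<mu> i * (d i)\<^sup>2))"
    by (intro E_mono l2_stat_variance) simp
  also have "\<dots> = 8 * (real m)\<^sup>2 * (\<Sum>i=1..n. ?W i * (\<mu> i)\<^sup>2) +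
      8 * (real m)^3 * (\<Sum>i=1..n. ?W i * \<mu> i * (d i)\<^sup>2)"
    by (simp add: E_add E_sum)
  also have "\<dots> = (\<Sum>i=1..n. 8 * ((lam i)\<^sup>2 * ?W i)) +
      8 * (real m)\<^sup>2 * (\<Sum>i=1..n. (d i)\<^sup>2 * (lam i * ?W i))"
    by (simp add: sum_distrib_left lam_def power2_eq_square power3_eq_cube mult_ac)
  also have "\<dots> \<le> (\<Sum>i=1..n. 16) + 8 * (real m)\<^sup>2 * (\<Sum>i=1..n. (d i)\<^sup>2 * (4 / (1 + lam i)))"
  proof (intro add_mono sum_mono mult_left_mono)
    fix i
    show "8 * ((lam i)\<^sup>2 * ?W i) \<le> 16" using E_weight_square[of i] by simp
    \<comment> \<open>Small \<open>lam i\<close> is settled by weights being at most 1, large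
      \<open>lam i\<close> by the second moment. Adding the bound on \<open>(lam i)^2 * ?W i\<close>
      yields the factor \<open>1 + lam i\<close>.\<close>
    have "lam i * ?W i \<le> 2"
    proof (cases "lam i \<le> 1")
      case True
      then have "lam i * ?W i \<le> 1 * 1"
        using W0 lam_nonneg E_weight_square_le_1 by (intro mult_mono) auto
      then show ?thesis by simp
    next
      case False
      then have "lam i * 1 * ?W i \<le> lam i * lam i * ?W i"
        using W0 by (intro mult_right_mono mult_left_mono) auto
      then show ?thesis using E_weight_square[of i] by (simp add: power2_eq_square)
    qed
    then have "lam i * ?W i * (1 + lam i) \<le> 4"
      using E_weight_square[of i] by (simp add: power2_eq_square algebra_simps)
    then show "lam i * ?W i \<le> 4 / (1 + lam i)"
      using lam_nonneg[of i] by (simp add: pos_le_divide_eq)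
  qed auto
  also have "(\<Sum>i=1..n. (d i)\<^sup>2 * (4 / (1 + lam i))) = 4 * D"
    by (simp add: D_def sum_distrib_left mult_ac)
  finally show ?thesis by (simp add: mult_ac)
qed

section \<open>Errors caused by the random counts\<close>

definition heavy :: "nat set" where "heavy = {i\<in>{1..n}. 1 \<le> lam i}"

definition log_error :: "nat list \<Rightarrow> real" where
  "log_error xs = (\<Sum>i\<in>heavy. (1 + lam i) * (ln ((1 + real (count_list xs i)) / lam i))\<^sup>2)"

lemma log_error_nonneg: "0 \<le> log_error xs"
  unfolding log_error_def using lam_nonneg
  by (intro sum_nonneg mult_nonneg_nonneg) (auto intro: add_nonneg_nonneg)

text \<open>For \<open>Z = (1 + c i) / lam i\<close> the squared logarithm is at most
  \<open>Z - 2 + 1 / Z\<close>. The mean of \<open>Z\<close> is \<open>1 + 1 / lam i\<close> and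
  that of \<open>1 / Z\<close> is at most 1, which leaves \<open>1 / lam i\<close>; the factor
  \<open>1 + lam i\<close> is at most \<open>2 * lam i\<close> on heavy elements.\<close>

lemma E_log_error: "E Xs log_error \<le> 2 * real n"
proof -
  have "E Xs log_error =
      (\<Sum>i\<in>heavy. (1 + lam i) * E Xs (\<lambda>xs. (ln ((1 + real (count_list xs i)) / lam i))\<^sup>2))"
    unfolding log_error_def by (simp add: E_sum)
  also have "\<dots> \<le> (\<Sum>i\<in>heavy. 2)"
  proof (rule sum_mono)
    fix i assume "i \<in> heavy"
    then have li: "1 \<le> lam i" by (simp add: heavy_def)
    have pt: "(ln ((1 + real k) / lam i))\<^sup>2 \<le>
        ((1 + real k) - 2 * lam i + (lam i)\<^sup>2 * (1 / (1 + real k))) / lam i" for k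
    proof -
      have "(ln ((1 + real k) / lam i))\<^sup>2 \<le> ((1 + real k) / lam i - 1)\<^sup>2 / ((1 + real k) / lam i)"
        using li by (intro ln_square_le divide_pos_pos) auto
      also have "\<dots> = ((1 + real k) - 2 * lam i + (lam i)\<^sup>2 * (1 / (1 + real k))) / lam i"
      proof -
        have "(z / l - 1)\<^sup>2 / (z / l) = (z - 2 * l + l\<^sup>2 * (1 / z)) / l" if "0 < z" "0 < l" for z l :: real
          using that by (simp add: power2_eq_square field_simps)
        from this[of "1 + real k" "lam i"] show ?thesis using li by (simp add: add_pos_nonneg)
      qed
      finally show ?thesis .
    qed
    have "E Xs (\<lambda>xs. (ln ((1 + real (count_list xs i)) / lam i))\<^sup>2) \<le>
      E Xs (\<lambda>xs. ((1 + real (count_list xs i)) - 2 * lam i + (lam i)\<^sup>2 * weight xs i) / lam i)"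
      unfolding weight_def by (intro E_mono pt) simp
    also have "\<dots> = ((1 + lam i) - 2 * lam i + lam i * (lam i * E Xs (\<lambda>xs. weight xs i))) / lam i"
      using E_one_plus_count[of i] by (simp add: E_add E_diff power2_eq_square)
    also have "\<dots> \<le> ((1 + lam i) - 2 * lam i + lam i * 1) / lam i"
      using li E_weight[of i] by (intro divide_right_mono add_left_mono mult_left_mono) auto
    also have "\<dots> = 1 / lam i" by simp
    finally have "(1 + lam i) * E Xs (\<lambda>xs. (ln ((1 + real (count_list xs i)) / lam i))\<^sup>2) \<le>
        (1 + lam i) * (1 / lam i)"
      using li by (intro mult_left_mono) auto
    also have "\<dots> \<le> 2" using li by (simp add: field_simps)
    finally show "(1 + lam i) * E Xs (\<lambda>xs. (ln ((1 + real (count_list xs i)) / lam i))\<^sup>2) \<le> 2" .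
  qed
  also have "\<dots> \<le> 2 * real n"
  proof -
    have "card heavy \<le> card {1..n}" unfolding heavy_def by (intro card_mono) auto
    then show ?thesis by simp
  qed
  finally show ?thesis .
qed

text \<open>Since \<open>1 / weight\<close> has a simple expectation, Cauchy-Schwarz and Markov applied to this quantity
  bound the weighted norm from below (see \<open>D_square_le\<close>).\<close>

definition weight_defect :: "nat list \<Rightarrow> real" where
  "weight_defect xs = (\<Sum>i=1..n. (d i)\<^sup>2 / (1 + lam i)\<^sup>2 * (1 + real (count_list xs i)))"

lemma weight_defect_nonneg: "0 \<le> weight_defect xs"
  unfolding weight_defect_def by (intro sum_nonneg) (simp add: add_nonneg_nonneg)

lemma E_weight_defect: "E Xs weight_defect = D"
proof -
  have "E Xs weight_defect = (\<Sum>i=1..n. (d i)\<^sup>2 / (1 + lam i)\<^sup>2 * (1 + lam i))"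
    unfolding weight_defect_def E_sum[OF fin_Xs] E_one_plus_count[symmetric]
    by (intro sum.cong refl integral_mult_right_zero)
  also have "\<dots> = D"
    unfolding D_def
  proof (rule sum.cong[OF refl])
    fix i
    have "1 + lam i \<noteq> 0" using lam_nonneg[of i] by simp
    then show "(d i)\<^sup>2 / (1 + lam i)\<^sup>2 * (1 + lam i) = (d i)\<^sup>2 / (1 + lam i)"
      by (simp add: power2_eq_square)
  qed
  finally show ?thesis .
qed

lemma D_square_le: "D\<^sup>2 \<le> (\<Sum>i=1..n. weight xs i * (d i)\<^sup>2) * weight_defect xs"
proof -
  let ?a = "\<lambda>i. sqrt (weight xs i) * \<bar>d i\<bar>"
    and ?b = "\<lambda>i. \<bar>d i\<bar> / (1 + lam i) * sqrt (1 + real (count_list xs i))"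
  have ab: "?a i * ?b i = (d i)\<^sup>2 / (1 + lam i)" for i
  proof -
    have "sqrt (weight xs i) * sqrt (1 + real (count_list xs i)) = 1"
      by (simp add: real_sqrt_mult[symmetric] weight_def)
    moreover have "?a i * ?b i = (\<bar>d i\<bar> * \<bar>d i\<bar>) / (1 + lam i) *
        (sqrt (weight xs i) * sqrt (1 + real (count_list xs i)))"
      by (simp add: mult_ac)
    ultimately show ?thesis by (simp add: power2_eq_square)
  qed
  have "D\<^sup>2 = (\<Sum>i=1..n. ?a i * ?b i)\<^sup>2" unfolding ab D_def ..
  also have "\<dots> \<le> (\<Sum>i=1..n. (?a i)\<^sup>2) * (\<Sum>i=1..n. (?b i)\<^sup>2)"
    by (rule Cauchy_Schwarz_ineq_sum)
  also have "\<dots> = (\<Sum>i=1..n. weight xs i * (d i)\<^sup>2) * weight_defect xs"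
    by (simp add: power_mult_distrib power_divide weight_defect_def add_nonneg_nonneg)
  finally show ?thesis .
qed

text \<open>One joint distribution of the three batches, so that \<open>prob_le_E\<close> can add up
  errors that depend on different batches.\<close>

definition trial :: "(nat list \<times> (nat \<times> nat) list \<times> (nat \<times> nat) list) pmf" where
  "trial = pair_pmf Xs (pair_pmf Us Us)"

lemma fin_trial [simp]: "finite (set_pmf trial)"
  by (simp add: trial_def)

lemma E_trial: "E trial F = E Xs (\<lambda>xs. E Us (\<lambda>us. E Us (\<lambda>vs. F (xs, us, vs))))"
  by (simp add: trial_def E_pair)

lemma tester_eq: "tester n \<epsilon> m p q = map_pmf (\<lambda>(xs, us, vs). verdict n \<epsilon> m xs us vs) trial"
  by (simp add: tester_def trial_def pair_pmf_def map_bind_pmf bind_assoc_pmf bind_return_pmf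
      Xs_def Us_def PQ_def)

lemma log_count_bounds:
  assumes "xs \<in> set_pmf Xs"
  shows "0 \<le> log_count xs i" "log_count xs i \<le> ln (real m + 1)"
proof -
  have "count_list xs i \<le> m"
    using assms count_le_length[of xs i] by (auto simp: Xs_def set_replicate_pmf)
  then show "0 \<le> log_count xs i" "log_count xs i \<le> ln (real m + 1)"
    by (simp_all add: log_count_def)
qed

text \<open>Counts are at most \<open>m\<close>, so every summand is at most
  \<open>ln (m + 1)\<close> in absolute value. This crude bound is the source of the term of order
  \<open>log^2 / \<epsilon>^2\<close> in the sample size.\<close>

lemma log_stat_variance:
  assumes "xs \<in> set_pmf Xs"
  shows "E Us (\<lambda>vs. (log_stat xs vs - real m * (\<Sum>i=1..n. d i * log_count xs i))\<^sup>2)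
    \<le> real m * (ln (real m + 1))\<^sup>2"
proof -
  have "E Us (\<lambda>vs. (log_stat xs vs - real m * (\<Sum>i=1..n. d i * log_count xs i))\<^sup>2)
      \<le> real m * E PQ (\<lambda>v. (diff (log_count xs) v)\<^sup>2)"
    unfolding log_stat_def Us_def E_diff_PQ[symmetric] by (rule iid_sum_variance) simp
  also have "\<dots> \<le> real m * E PQ (\<lambda>_. (ln (real m + 1))\<^sup>2)"
  proof (intro mult_left_mono E_mono)
    fix v
    have "\<bar>diff (log_count xs) v\<bar> \<le> ln (real m + 1)"
      using log_count_bounds[OF assms, of "fst v"] log_count_bounds[OF assms, of "snd v"]
      unfolding diff_def by linarith
    then have "\<bar>diff (log_count xs) v\<bar>\<^sup>2 \<le> (ln (real m + 1))\<^sup>2" by (intro power_mono) auto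
    then show "(diff (log_count xs) v)\<^sup>2 \<le> (ln (real m + 1))\<^sup>2" by simp
  qed auto
  finally show ?thesis by simp
qed

end

section \<open>Error probabilities of the tester\<close>

context two_sources
begin

lemma shannon_entropy_p: "shannon_entropy p = (\<Sum>i=1..n. plogp (pmf p i))"
  and shannon_entropy_q: "shannon_entropy q = (\<Sum>i=1..n. plogp (pmf q i))"
  unfolding shannon_entropy_def plogp_def using supp_p supp_q
  by (auto intro!: sum.mono_neutral_left simp: set_pmf_iff)

text \<open>The Chebyshev quotient at the threshold of \<open>verdict\<close>: 320 is
  \<open>16 * 20\<close>, with 16 from the squared threshold and 20 from the target
  probability.\<close>

lemma log_stat_le:
  assumes "0 < \<epsilon>" and "320 * (ln (real m + 1))\<^sup>2 \<le> \<epsilon>\<^sup>2 * real m"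
  shows "E trial (\<lambda>(xs, us, vs). (log_stat xs vs - real m * (\<Sum>i=1..n. d i * log_count xs i))\<^sup>2
      / (real m * \<epsilon> / 4)\<^sup>2) \<le> 1 / 20"
proof -
  have "E trial (\<lambda>(xs, us, vs). (log_stat xs vs - real m * (\<Sum>i=1..n. d i * log_count xs i))\<^sup>2
      / (real m * \<epsilon> / 4)\<^sup>2) =
    E Xs (\<lambda>xs. E Us (\<lambda>vs. (log_stat xs vs - real m * (\<Sum>i=1..n. d i * log_count xs i))\<^sup>2))
      / (real m * \<epsilon> / 4)\<^sup>2"
    by (simp add: E_trial)
  also have "\<dots> \<le> E Xs (\<lambda>_. real m * (ln (real m + 1))\<^sup>2) / (real m * \<epsilon> / 4)\<^sup>2"
    by (intro divide_right_mono E_mono log_stat_variance) auto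
  also have "\<dots> = 16 * (ln (real m + 1))\<^sup>2 / (\<epsilon>\<^sup>2 * real m)"
    using m assms(1) by (simp add: power2_eq_square field_simps)
  also have "\<dots> \<le> 1 / 20"
    using m assms by (simp add: divide_simps)
  finally show ?thesis .
qed

text \<open>For equal distributions both statistics are centred and \<open>D = 0\<close>, so the
  thresholds are exceeded with probability at most \<open>1 / 40\<close> and
  \<open>1 / 20\<close>.\<close>

lemma tester_accepts:
  assumes "p = q" "0 < \<epsilon>" "320 * (ln (real m + 1))\<^sup>2 \<le> \<epsilon>\<^sup>2 * real m"
  shows "measure_pmf.prob (tester n \<epsilon> m p q) {True} \<ge> 9 / 10"
proof -
  have d0: "d i = 0" for i unfolding d_def using assms(1) by simp
  have D0: "D = 0" by (simp add: D_def d0)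
  let ?V = "\<lambda>(xs, us, vs). (log_stat xs vs - real m * (\<Sum>i=1..n. d i * log_count xs i))\<^sup>2
      / (real m * \<epsilon> / 4)\<^sup>2"
  let ?T = "\<lambda>(xs, us, vs). (l2_stat xs us vs)\<^sup>2 / (640 * real n)"
  let ?bad = "{(xs, us, vs). \<not> verdict n \<epsilon> m xs us vs}"
  have pos: "0 < (real m * \<epsilon> / 4)\<^sup>2" "0 < 640 * real n" using m n assms by auto
  have "measure_pmf.prob trial ?bad \<le> E trial (\<lambda>w. ?T w + ?V w)"
  proof (rule prob_le_E)
    fix w :: "nat list \<times> (nat \<times> nat) list \<times> (nat \<times> nat) list"
    show "0 \<le> ?T w + ?V w" by (auto split: prod.splits)
    assume "w \<in> ?bad"
    then obtain xs us vs where w: "w = (xs, us, vs)" "\<not> verdict n \<epsilon> m xs us vs" by auto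
    then consider "640 * real n \<le> (l2_stat xs us vs)\<^sup>2" | "(real m * \<epsilon> / 4)\<^sup>2 \<le> (log_stat xs vs)\<^sup>2"
      unfolding verdict_def by linarith
    then show "1 \<le> ?T w + ?V w"
    proof cases
      case 1
      then have "1 \<le> ?T w" using pos by (simp add: w)
      moreover have "0 \<le> ?V w" by (simp add: w)
      ultimately show ?thesis by linarith
    next
      case 2
      then have "1 \<le> ?V w" using pos by (simp add: w d0)
      moreover have "0 \<le> ?T w" by (simp add: w)
      ultimately show ?thesis by linarith
    qed
  qed simp
  also have "\<dots> = E trial ?T + E trial ?V" by (rule E_add) simp
  also have "E trial ?T \<le> 1 / 40"
  proof -
    have "E trial ?T = E Xs (\<lambda>xs. E Us (\<lambda>us. E Us (\<lambda>vs. (l2_stat xs us vs)\<^sup>2))) / (640 * real n)"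
      by (simp add: E_trial)
    also have "\<dots> \<le> (16 * real n) / (640 * real n)"
      using l2_stat_total_variance by (intro divide_right_mono) (auto simp: d0 D0)
    finally show ?thesis using n by simp
  qed
  also have "E trial ?V \<le> 1 / 20" using assms(2,3) by (rule log_stat_le)
  finally have "measure_pmf.prob trial ?bad \<le> 1 / 10" by simp
  moreover have "measure_pmf.prob (tester n \<epsilon> m p q) {True} = 1 - measure_pmf.prob trial ?bad"
  proof -
    have "measure_pmf.prob (tester n \<epsilon> m p q) {True} = measure_pmf.prob trial (UNIV - ?bad)"
      by (simp add: tester_eq) (rule arg_cong[where f = "measure_pmf.prob trial"], auto)
    also have "\<dots> = 1 - measure_pmf.prob trial ?bad"
      using measure_pmf.prob_compl[of ?bad trial] by simp
    finally show ?thesis .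
  qed
  ultimately show ?thesis by simp
qed

text \<open>Two bad events have probability at most \<open>1 / 20\<close> each:
  \<open>weight_defect xs\<close> reaches \<open>20 * D\<close> (Markov), or the statistic misses
  its mean given \<open>xs\<close> by \<open>u / 40\<close> (Chebyshev). Otherwise
  \<open>D_square_le\<close> puts that mean at \<open>u / 20\<close> or more, out of reach of the
  acceptance threshold.\<close>

lemma accept_unlikely_if_l2_far:
  assumes far: "2000000 * sqrt (real n) \<le> (real m)\<^sup>2 * D"
  shows "measure_pmf.prob trial {(xs, us, vs). verdict n \<epsilon> m xs us vs} \<le> 1 / 10"
proof -
  define u where "u = (real m)\<^sup>2 * D"
  have sn: "1 \<le> sqrt (real n)" using n by simp
  have u: "2000000 * sqrt (real n) \<le> u" using far by (simp add: u_def)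
  have upos: "2000000 \<le> u" using u sn by linarith
  have Dpos: "0 < D"
  proof (rule ccontr)
    assume "\<not> 0 < D"
    then have "D = 0" using D_nonneg by linarith
    then show False using upos by (simp add: u_def)
  qed
  let ?S = "\<lambda>xs. \<Sum>i=1..n. weight xs i * (d i)\<^sup>2"
  let ?X = "\<lambda>(xs, us, vs). weight_defect xs / (20 * D)"
  let ?T = "\<lambda>(xs, us, vs). (l2_stat xs us vs - (real m)\<^sup>2 * ?S xs)\<^sup>2 / (u / 40)\<^sup>2"
  have "measure_pmf.prob trial {(xs, us, vs). verdict n \<epsilon> m xs us vs} \<le> E trial (\<lambda>w. ?X w + ?T w)"
  proof (rule prob_le_E)
    fix w :: "nat list \<times> (nat \<times> nat) list \<times> (nat \<times> nat) list"
    show "0 \<le> ?X w + ?T w"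
      using Dpos weight_defect_nonneg by (auto split: prod.splits intro!: add_nonneg_nonneg)
    assume "w \<in> {(xs, us, vs). verdict n \<epsilon> m xs us vs}"
    then obtain xs us vs where w: "w = (xs, us, vs)" "verdict n \<epsilon> m xs us vs" by auto
    show "1 \<le> ?X w + ?T w"
    proof (cases "D / 20 \<le> ?S xs")
      case True
      have "(l2_stat xs us vs)\<^sup>2 \<le> 640 * real n" using w by (simp add: verdict_def)
      \<comment> \<open>\<open>26^2 = 676\<close> exceeds 640.\<close>
      also have "\<dots> \<le> (26 * sqrt (real n))\<^sup>2" by (simp add: power_mult_distrib)
      finally have "\<bar>l2_stat xs us vs\<bar> \<le> 26 * sqrt (real n)"
        using sn by (intro abs_le_square_iff[THEN iffD2, of _ "26 * sqrt (real n)", simplified]) simp_all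
      also have "\<dots> \<le> u / 40" using u sn by linarith
      finally have "l2_stat xs us vs \<le> u / 40" by linarith
      moreover have "u / 20 \<le> (real m)\<^sup>2 * ?S xs"
        using mult_left_mono[OF True, of "(real m)\<^sup>2"] by (simp add: u_def)
      ultimately have "(u / 40)\<^sup>2 \<le> ((real m)\<^sup>2 * ?S xs - l2_stat xs us vs)\<^sup>2"
        using upos by (intro power_mono) auto
      then have "1 \<le> ?T w" using upos by (simp add: w power2_commute)
      moreover have "0 \<le> ?X w" using Dpos weight_defect_nonneg by (simp add: w)
      ultimately show ?thesis by linarith
    next
      case False
      have "D * D \<le> ?S xs * weight_defect xs" using D_square_le by (simp add: power2_eq_square)
      also have "\<dots> \<le> D / 20 * weight_defect xs"
        using False weight_defect_nonneg by (intro mult_right_mono) auto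
      finally have "20 * D \<le> weight_defect xs" using Dpos by (simp add: field_simps)
      then have "1 \<le> ?X w" using Dpos by (simp add: w)
      moreover have "0 \<le> ?T w" by (simp add: w)
      ultimately show ?thesis by linarith
    qed
  qed simp
  also have "\<dots> = E trial ?X + E trial ?T" by (rule E_add) simp
  also have "E trial ?X = 1 / 20"
    using Dpos by (simp add: E_trial E_weight_defect)
  also have "E trial ?T \<le> (16 * real n + 32 * u) / (u / 40)\<^sup>2"
  proof -
    have "E trial ?T = E Xs (\<lambda>xs. E Us (\<lambda>us. E Us (\<lambda>vs.
      (l2_stat xs us vs - (real m)\<^sup>2 * ?S xs)\<^sup>2))) / (u / 40)\<^sup>2"
      by (simp add: E_trial)
    also have "\<dots> \<le> (16 * real n + 32 * u) / (u / 40)\<^sup>2"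
      unfolding u_def by (intro divide_right_mono l2_stat_total_variance) simp
    finally show ?thesis .
  qed
  also have "\<dots> \<le> 1 / 20"
  proof -
    define s where "s = u * u"
    \<comment> \<open>The term \<open>32 * u\<close> determines the constant:
      \<open>20 * 32 * u \<le> u^2 / 1600\<close> holds from \<open>u = 1024000\<close> on, and
      2000000 leaves room for the term in \<open>n\<close>.\<close>
    have "2000000 * u \<le> s" unfolding s_def using upos by (intro mult_right_mono) auto
    moreover have "(2000000 * sqrt (real n))\<^sup>2 \<le> u\<^sup>2" using u by (intro power_mono) auto
    then have "4000000000000 * real n \<le> s" by (simp add: s_def power_mult_distrib power2_eq_square)
    then have "320 * real n \<le> s / 32000" using upos by simp
    ultimately have "20 * (16 * real n + 32 * u) \<le> s / 1600" by simp
    then have "20 * (16 * real n + 32 * u) \<le> (u / 40)\<^sup>2" by (simp add: s_def power2_eq_square)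
    then show ?thesis using upos by (simp add: divide_simps)
  qed
  finally show ?thesis by simp
qed

text \<open>In the scale \<open>z = n^(3/4) / m\<close>, every error term of
  \<open>entropy_diff_bound\<close> is at most a multiple of \<open>z\<close> or of
  \<open>l * z\<close>, and \<open>c1\<close> is the fourth power of
  \<open>10000000 * l * z \<le> \<epsilon>\<close>, cleared of denominators. The errors therefore
  use up at most half of the entropy gap.\<close>

lemma log_mean_large:
  assumes \<epsilon>: "0 < \<epsilon>" "\<epsilon> \<le> 1 / 2"
    and c1: "(10000000 * ln (real m + 1)) ^ 4 * real n ^ 3 \<le> (\<epsilon> * real m) ^ 4"
    and close: "(real m)\<^sup>2 * D < 2000000 * sqrt (real n)"
    and ent: "\<epsilon> \<le> \<bar>shannon_entropy p - shannon_entropy q\<bar>"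
    and err: "log_error xs \<le> 40 * real n" and xs: "xs \<in> set_pmf Xs"
  shows "\<epsilon> / 2 \<le> \<bar>\<Sum>i=1..n. d i * log_count xs i\<bar>"
proof -
  define l where "l = ln (real m + 1)"
  \<comment> \<open>With \<open>a = n^(1/4)\<close>, all fractional powers of \<open>n\<close>
    become integral powers of \<open>a\<close>.\<close>
  define a where "a = root 4 (real n)"
  have a1: "1 \<le> a" using n by (simp add: a_def)
  have a4: "real n = a ^ 4" by (simp add: a_def)
  have l1: "1 \<le> 2 * l"
  proof -
    have "ln 2 \<le> l" unfolding l_def using m by simp
    then show ?thesis using ln2_ge_two_thirds by linarith
  qed
  define z where "z = a ^ 3 / real m"
  have z0: "0 < z" using a1 m by (simp add: z_def)
  have "(10000000 * l * a ^ 3) ^ 4 \<le> (\<epsilon> * real m) ^ 4"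
    using c1 unfolding a4 l_def[symmetric] by (simp add: power_mult_distrib power_mult[symmetric])
  then have "10000000 * l * a ^ 3 \<le> \<epsilon> * real m"
    using l1 a1 \<epsilon> by (simp add: power_mono_iff)
  then have lz: "10000000 * (l * z) \<le> \<epsilon>"
    using m by (simp add: z_def field_simps)
  have z2: "z \<le> 2 * (l * z)" using mult_right_mono[OF l1, of z] z0 by simp
  have Dle: "D \<le> 2000000 * a\<^sup>2 / (real m)\<^sup>2"
  proof -
    have "sqrt (real n) = a\<^sup>2"
      unfolding a4 using a1 by (intro real_sqrt_unique) (simp_all add: power_mult[symmetric])
    then show ?thesis using close m by (simp add: field_simps)
  qed
  have zz: "z\<^sup>2 = a ^ 6 / (real m)\<^sup>2" by (simp add: z_def power_divide power_mult[symmetric])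
  have t1: "real m / 2 * D \<le> 1000000 * z"
  proof -
    have "real m / 2 * D \<le> real m / 2 * (2000000 * a\<^sup>2 / (real m)\<^sup>2)"
      using Dle by (intro mult_left_mono) auto
    also have "\<dots> = 1000000 * a\<^sup>2 / real m" using m by (simp add: power2_eq_square)
    also have "\<dots> \<le> 1000000 * a ^ 3 / real m"
      using a1 power_increasing[of 2 3 a] by (intro divide_right_mono) auto
    finally show ?thesis by (simp add: z_def)
  qed
  have t2: "sqrt (D * log_error xs) \<le> 9000 * z"
  proof (rule real_le_lsqrt)
    have "D * log_error xs \<le> (2000000 * a\<^sup>2 / (real m)\<^sup>2) * (40 * a ^ 4)"
      using Dle err log_error_nonneg D_nonneg unfolding a4 by (intro mult_mono) auto
    also have "\<dots> = 80000000 * z\<^sup>2"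
      unfolding zz by (simp add: power_add[symmetric])
    also have "\<dots> \<le> (9000 * z)\<^sup>2" by (simp add: power_mult_distrib)
    finally show "D * log_error xs \<le> (9000 * z)\<^sup>2" .
  qed (use z0 in auto)
  have t3: "sqrt (2 * real n * D) \<le> 2000 * z"
  proof (rule real_le_lsqrt)
    have "2 * real n * D \<le> 2 * a ^ 4 * (2000000 * a\<^sup>2 / (real m)\<^sup>2)"
      using Dle unfolding a4 by (intro mult_left_mono) auto
    also have "\<dots> = 4000000 * z\<^sup>2"
      unfolding zz by (simp add: power_add[symmetric])
    also have "\<dots> \<le> (2000 * z)\<^sup>2" by (simp add: power_mult_distrib)
    finally show "2 * real n * D \<le> (2000 * z)\<^sup>2" .
  qed (use z0 in auto)
  have t4: "real n * (2 * l) / (real m + 1)\<^sup>2 \<le> 2 * (l * z)"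
  proof -
    have "a ^ 3 \<le> real m"
    proof -
      have "0 \<le> l * z" using l1 z0 by (intro mult_nonneg_nonneg) linarith+
      then have "l * z \<le> \<epsilon>" using lz by linarith
      then have "z \<le> 1" using z2 \<epsilon> by linarith
      then show ?thesis using m by (simp add: z_def divide_simps)
    qed
    then have "a ^ 4 \<le> a ^ 3 * real m"
      using a1 power_increasing[of 1 3 a] mult_left_mono[of a "real m" "a ^ 3"]
      by (simp add: power_Suc2[of a 3, simplified])
    then have "a ^ 4 * (2 * l) / (real m)\<^sup>2 \<le> (a ^ 3 * real m) * (2 * l) / (real m)\<^sup>2"
      using l1 by (intro divide_right_mono mult_right_mono) auto
    also have "\<dots> = 2 * (l * z)" using m by (simp add: z_def power2_eq_square)
    finally have "a ^ 4 * (2 * l) / (real m)\<^sup>2 \<le> 2 * (l * z)" .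
    moreover have "a ^ 4 * (2 * l) / (real m + 1)\<^sup>2 \<le> a ^ 4 * (2 * l) / (real m)\<^sup>2"
      using l1 a1 m by (intro divide_left_mono power_mono) auto
    ultimately show ?thesis unfolding a4 by linarith
  qed
  have "\<bar>(\<Sum>i=1..n. plogp (pmf p i)) - (\<Sum>i=1..n. plogp (pmf q i))
      + (\<Sum>i=1..n. (pmf p i - pmf q i) * ln (1 + real (count_list xs i)))\<bar>
    \<le> real m / 2 * D + sqrt (D * log_error xs) + sqrt (2 * real n * D) * (1 + 3 * l)
      + real n * (2 * l) / (real m + 1)\<^sup>2"
  proof (rule entropy_diff_bound)
    show "(\<Sum>i=1..n. pmf p i) = 1" "(\<Sum>i=1..n. pmf q i) = 1"
      using supp_p supp_q by (auto intro: sum_pmf_eq_1)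
    show "count_list xs i \<le> m" for i
      using xs count_le_length[of xs i] by (auto simp: Xs_def set_replicate_pmf)
    show "lam i = real m * ((pmf p i + pmf q i) / 2)" for i by (simp add: lam_def \<mu>_def)
    show "D = (\<Sum>i=1..n. (pmf p i - pmf q i)\<^sup>2 / (1 + lam i))" by (simp add: D_def d_def)
  qed (use m in \<open>auto simp: log_error_def heavy_def l_def pmf_le_1\<close>)
  also have "\<dots> \<le> 1000000 * z + 9000 * z + 2000 * z * (1 + 3 * l) + 2 * (l * z)"
    using t1 t2 t3 t4 l1 by (intro add_mono mult_right_mono) auto
  also have "\<dots> = 1011000 * z + 6002 * (l * z)" by (simp add: algebra_simps)
  \<comment> \<open>By \<open>z2\<close> the sum is at most \<open>2028002 * (l * z)\<close>, less
    than half of \<open>10000000 * (l * z)\<close>.\<close>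
  also have "\<dots> \<le> \<epsilon> / 2" using lz z2 z0 \<epsilon> by linarith
  finally have "\<bar>shannon_entropy p - shannon_entropy q + (\<Sum>i=1..n. d i * log_count xs i)\<bar> \<le> \<epsilon> / 2"
    by (simp only: shannon_entropy_p shannon_entropy_q d_def log_count_def)
  then show ?thesis using ent by linarith
qed

text \<open>Again two bad events of probability at most \<open>1 / 20\<close>:
  \<open>log_error xs\<close> exceeds 20 times the bound on its mean, or the logarithmic statistic
  is off by \<open>m * \<epsilon> / 4\<close>. Otherwise its mean is at least
  \<open>m * \<epsilon> / 2\<close> in absolute value, and the statistic stays beyond the
  threshold.\<close>

lemma accept_unlikely_if_l2_close:
  assumes \<epsilon>: "0 < \<epsilon>" "\<epsilon> \<le> 1 / 2"
    and c1: "(10000000 * ln (real m + 1)) ^ 4 * real n ^ 3 \<le> (\<epsilon> * real m) ^ 4"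
    and c2: "320 * (ln (real m + 1))\<^sup>2 \<le> \<epsilon>\<^sup>2 * real m"
    and close: "(real m)\<^sup>2 * D < 2000000 * sqrt (real n)"
    and ent: "\<epsilon> \<le> \<bar>shannon_entropy p - shannon_entropy q\<bar>"
  shows "measure_pmf.prob trial {(xs, us, vs). verdict n \<epsilon> m xs us vs} \<le> 1 / 10"
proof -
  let ?S = "\<lambda>xs. \<Sum>i=1..n. d i * log_count xs i"
  let ?Y = "\<lambda>(xs, us, vs). log_error xs / (40 * real n)"
  let ?V = "\<lambda>(xs, us, vs). (log_stat xs vs - real m * ?S xs)\<^sup>2 / (real m * \<epsilon> / 4)\<^sup>2"
  have pos: "0 < real m * \<epsilon> / 4" using m \<epsilon> by simp
  have "measure_pmf.prob trial {(xs, us, vs). verdict n \<epsilon> m xs us vs} \<le> E trial (\<lambda>w. ?Y w + ?V w)"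
  proof (rule prob_le_E)
    fix w :: "nat list \<times> (nat \<times> nat) list \<times> (nat \<times> nat) list"
    show "0 \<le> ?Y w + ?V w"
      using log_error_nonneg by (auto split: prod.splits intro!: add_nonneg_nonneg)
    assume "w \<in> {(xs, us, vs). verdict n \<epsilon> m xs us vs}" "w \<in> set_pmf trial"
    then obtain xs us vs where w: "w = (xs, us, vs)" "verdict n \<epsilon> m xs us vs" "xs \<in> set_pmf Xs"
      by (auto simp: trial_def)
    show "1 \<le> ?Y w + ?V w"
    proof (cases "log_error xs \<le> 40 * real n")
      case True
      have "\<epsilon> / 2 \<le> \<bar>?S xs\<bar>"
        using \<epsilon> c1 close ent True w(3) by (rule log_mean_large)
      then have "real m * (\<epsilon> / 2) \<le> real m * \<bar>?S xs\<bar>" by (intro mult_left_mono) auto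
      then have "real m * \<epsilon> / 2 \<le> \<bar>real m * ?S xs\<bar>" by (simp add: abs_mult)
      moreover have "(log_stat xs vs)\<^sup>2 \<le> (real m * \<epsilon> / 4)\<^sup>2" using w by (simp add: verdict_def)
      then have "\<bar>log_stat xs vs\<bar> \<le> real m * \<epsilon> / 4"
        using pos abs_le_square_iff[of "log_stat xs vs" "real m * \<epsilon> / 4"] by linarith
      ultimately have "real m * \<epsilon> / 4 \<le> \<bar>log_stat xs vs - real m * ?S xs\<bar>" by linarith
      then have "(real m * \<epsilon> / 4)\<^sup>2 \<le> \<bar>log_stat xs vs - real m * ?S xs\<bar>\<^sup>2"
        using pos by (intro power_mono) auto
      then have "1 \<le> (log_stat xs vs - real m * ?S xs)\<^sup>2 / (real m * \<epsilon> / 4)\<^sup>2"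
        using m \<epsilon> by (subst le_divide_eq_1_pos) auto
      then have "1 \<le> ?V w" by (simp only: w prod.case)
      moreover have "0 \<le> ?Y w" using log_error_nonneg by (simp add: w)
      ultimately show ?thesis by linarith
    next
      case False
      then have "1 \<le> ?Y w" using n by (simp add: w)
      moreover have "0 \<le> ?V w" by (simp add: w)
      ultimately show ?thesis by linarith
    qed
  qed simp
  also have "\<dots> = E trial ?Y + E trial ?V" by (rule E_add) simp
  also have "E trial ?Y \<le> 1 / 20"
  proof -
    have "E trial ?Y = E Xs log_error / (40 * real n)" by (simp add: E_trial)
    also have "\<dots> \<le> 2 * real n / (40 * real n)" by (intro divide_right_mono E_log_error) simp
    finally show ?thesis using n by simp
  qed
  also have "E trial ?V \<le> 1 / 20" using \<epsilon>(1) c2 by (rule log_stat_le)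
  finally show ?thesis by simp
qed

lemma tester_rejects:
  assumes "0 < \<epsilon>" "\<epsilon> \<le> 1 / 2"
    and "(10000000 * ln (real m + 1)) ^ 4 * real n ^ 3 \<le> (\<epsilon> * real m) ^ 4"
    and "320 * (ln (real m + 1))\<^sup>2 \<le> \<epsilon>\<^sup>2 * real m"
    and "\<epsilon> \<le> \<bar>shannon_entropy p - shannon_entropy q\<bar>"
  shows "measure_pmf.prob (tester n \<epsilon> m p q) {False} \<ge> 9 / 10"
proof -
  let ?acc = "{(xs, us, vs). verdict n \<epsilon> m xs us vs}"
  have "measure_pmf.prob trial ?acc \<le> 1 / 10"
    using accept_unlikely_if_l2_far accept_unlikely_if_l2_close[OF assms(1-4) _ assms(5)]
    by (meson not_le)
  moreover have "measure_pmf.prob (tester n \<epsilon> m p q) {False} = measure_pmf.prob trial (UNIV - ?acc)"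
    by (simp add: tester_eq) (rule arg_cong[where f = "measure_pmf.prob trial"], auto)
  moreover have "measure_pmf.prob trial (UNIV - ?acc) = 1 - measure_pmf.prob trial ?acc"
    using measure_pmf.prob_compl[of ?acc trial] by simp
  ultimately show ?thesis by simp
qed

end

section \<open>Time-bounded runs of programs\<close>

definition tk :: "state \<Rightarrow> state" where
  "tk s = s\<lparr>steps := steps s + 1\<rparr>"

lemma tk_simps [simp]:
  "nmem (tk s) = nmem s" "rmem (tk s) = rmem s" "used_p (tk s) = used_p s"
  "used_q (tk s) = used_q s" "steps (tk s) = Suc (steps s)"
  by (simp_all add: tk_def)

lemma put_simps [simp]:
  "nmem (nput a v s) = (nmem s)(a := v)" "rmem (nput a v s) = rmem s"
  "used_p (nput a v s) = used_p s" "used_q (nput a v s) = used_q s" "steps (nput a v s) = steps s"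
  "nmem (rput a' w s) = nmem s" "rmem (rput a' w s) = (rmem s)(a' := w)"
  "used_p (rput a' w s) = used_p s" "used_q (rput a' w s) = used_q s" "steps (rput a' w s) = steps s"
  by (simp_all add: nput_def rput_def)

lemma tick_Pair [simp]: "tick (c, s) = (c, tk s)"
  by (simp add: tick_def tk_def)

locale machine =
  fixes p q :: "nat pmf"
begin

definition out :: "nat \<Rightarrow> com \<Rightarrow> state \<Rightarrow> state pmf" where
  "out B c s = map_pmf snd (run p q B (c, s))"

text \<open>\<open>B\<close> is a horizon that suffices on every random branch. Branches may halt at
  different times, so stability under all longer runs is what makes horizons compose; the time
  charged to a branch is recorded in \<open>steps\<close>.\<close>

definition halts :: "nat \<Rightarrow> com \<Rightarrow> state \<Rightarrow> bool" where
  "halts B c s \<longleftrightarrow> (\<forall>T\<ge>B. run p q T (c, s) = map_pmf (Pair Skip) (out B c s))"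

lemma haltsI:
  assumes "\<And>T. B \<le> T \<Longrightarrow> run p q T (c, s) = map_pmf (Pair Skip) M"
  shows "halts B c s" "out B c s = M"
proof -
  show "out B c s = M" using assms[of B] by (simp add: out_def pmf.map_comp o_def)
  with assms show "halts B c s" by (simp add: halts_def)
qed

lemma halts_mono:
  assumes "halts B c s" "B \<le> B'"
  shows "halts B' c s" "out B' c s = out B c s"
  using assms haltsI[of B' c s "out B c s"] by (auto simp: halts_def)

lemma run_Skip [simp]: "run p q T (Skip, s) = return_pmf (Skip, s)"
  by (cases T) simp_all

text \<open>Induction on the horizon of the first command. Branches that halt early leave more time
  for \<open>d\<close>, so the outcome \<open>F\<close> must be the same for every remaining time
  from \<open>B'\<close> on. The additional 1, and the tick before \<open>d\<close> starts, are the
  step from \<open>Seq Skip d\<close> to \<open>d\<close>.\<close>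

lemma run_Seq:
  assumes "\<And>cfg. cfg \<in> set_pmf (run p q B (c, s)) \<Longrightarrow> fst cfg = Skip"
    and "\<And>cfg T. cfg \<in> set_pmf (run p q B (c, s)) \<Longrightarrow> B' \<le> T \<Longrightarrow>
      run p q T (d, tk (snd cfg)) = F (snd cfg)"
    and "B + 1 + B' \<le> T"
  shows "run p q T (Seq c d, s) = run p q B (c, s) \<bind> (\<lambda>cfg. F (snd cfg))"
  using assms
proof (induction B arbitrary: c s T)
  case 0
  then obtain T' where T: "T = Suc T'" "B' \<le> T'" by (cases T) auto
  have "c = Skip" using 0(1)[of "(c, s)"] by simp
  then show ?case using T 0(2)[of "(c, s)" T'] by (simp add: bind_return_pmf)
next
  case (Suc B)
  then obtain T' where T: "T = Suc T'" "B + 1 + B' \<le> T'" by (cases T) auto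
  show ?case
  proof (cases "c = Skip")
    case True
    then show ?thesis using T Suc.prems(2)[of "(c, s)" T'] by (simp add: bind_return_pmf)
  next
    case False
    have "run p q T (Seq c d, s) =
        step p q c s \<bind> (\<lambda>cs. run p q T' (Seq (fst cs) d, tk (snd cs)))"
      using False T by (simp add: bind_map_pmf case_prod_unfold)
    also have "\<dots> = step p q c s \<bind> (\<lambda>cs. run p q B (fst cs, tk (snd cs)) \<bind> (\<lambda>cfg. F (snd cfg)))"
    proof (rule bind_pmf_cong[OF refl])
      fix cs assume cs: "cs \<in> set_pmf (step p q c s)"
      have sub: "set_pmf (run p q B (fst cs, tk (snd cs))) \<subseteq> set_pmf (run p q (Suc B) (c, s))"
        using False cs by (cases cs) (auto simp: bind_map_pmf intro!: bexI[of _ cs])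
      show "run p q T' (Seq (fst cs) d, tk (snd cs)) =
          run p q B (fst cs, tk (snd cs)) \<bind> (\<lambda>cfg. F (snd cfg))"
      proof (rule Suc.IH[OF _ _ T(2)])
        fix cfg assume "cfg \<in> set_pmf (run p q B (fst cs, tk (snd cs)))"
        then have cfg: "cfg \<in> set_pmf (run p q (Suc B) (c, s))" using sub by blast
        show "fst cfg = Skip" by (rule Suc.prems(1)[OF cfg])
        show "run p q T (d, tk (snd cfg)) = F (snd cfg)" if "B' \<le> T" for T
          by (rule Suc.prems(2)[OF cfg that])
      qed
    qed
    also have "\<dots> = run p q (Suc B) (c, s) \<bind> (\<lambda>cfg. F (snd cfg))"
      using False by (simp add: bind_map_pmf bind_assoc_pmf tick_def map_prod_def tk_def case_prod_unfold)
    finally show ?thesis .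
  qed
qed

lemma halts_Seq:
  assumes c: "halts B c s" and d: "\<And>s'. s' \<in> set_pmf (out B c s) \<Longrightarrow> halts B' d (tk s')"
  shows "halts (B + 1 + B') (Seq c d) s"
    and "out (B + 1 + B') (Seq c d) s = out B c s \<bind> (\<lambda>s'. out B' d (tk s'))"
proof -
  have runc: "run p q B (c, s) = map_pmf (Pair Skip) (out B c s)"
    using c by (simp add: halts_def)
  have "run p q T (Seq c d, s) =
      map_pmf (Pair Skip) (out B c s \<bind> (\<lambda>s'. out B' d (tk s')))" if "B + 1 + B' \<le> T" for T
  proof -
    have "run p q T (Seq c d, s) =
        run p q B (c, s) \<bind> (\<lambda>cfg. map_pmf (Pair Skip) (out B' d (tk (snd cfg))))"
      using that d by (intro run_Seq[where B' = B']) (auto simp: runc halts_def)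
    then show ?thesis by (simp add: runc bind_map_pmf map_bind_pmf)
  qed
  from haltsI[OF this] show "halts (B + 1 + B') (Seq c d) s"
    and "out (B + 1 + B') (Seq c d) s = out B c s \<bind> (\<lambda>s'. out B' d (tk s'))"
    by blast+
qed

lemma halts_Cond:
  assumes "halts B (if tval t s then c else d) (tk s)"
  shows "halts (Suc B) (Cond t c d) s"
    and "out (Suc B) (Cond t c d) s = out B (if tval t s then c else d) (tk s)"
proof -
  have "run p q T (Cond t c d, s) =
      map_pmf (Pair Skip) (out B (if tval t s then c else d) (tk s))" if "Suc B \<le> T" for T
    using that assms by (cases T) (auto simp: halts_def bind_return_pmf)
  from haltsI[OF this] show "halts (Suc B) (Cond t c d) s"
    and "out (Suc B) (Cond t c d) s = out B (if tval t s then c else d) (tk s)"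
    by blast+
qed

lemma halts_Loop_step:
  assumes "tval t s" "halts B (Seq c (Loop t c)) (tk s)"
  shows "halts (Suc B) (Loop t c) s" "out (Suc B) (Loop t c) s = out B (Seq c (Loop t c)) (tk s)"
proof -
  have "run p q T (Loop t c, s) = map_pmf (Pair Skip) (out B (Seq c (Loop t c)) (tk s))"
    if "Suc B \<le> T" for T
    using that assms by (cases T) (auto simp: halts_def bind_return_pmf)
  from haltsI[OF this] show "halts (Suc B) (Loop t c) s" "out (Suc B) (Loop t c) s = out B (Seq c (Loop t c)) (tk s)"
    by blast+
qed

lemma halts_Loop_end:
  assumes "\<not> tval t s"
  shows "halts 1 (Loop t c) s" "out 1 (Loop t c) s = return_pmf (tk s)"
proof -
  have "run p q T (Loop t c, s) = map_pmf (Pair Skip) (return_pmf (tk s))" if "1 \<le> T" for T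
    using that assms by (cases T) (auto simp: bind_return_pmf)
  from haltsI[OF this] show "halts 1 (Loop t c) s" "out 1 (Loop t c) s = return_pmf (tk s)"
    by blast+
qed

section \<open>Loop-free commands as state transformers\<close>

primrec loop_free :: "com \<Rightarrow> bool" where
  "loop_free Skip \<longleftrightarrow> True"
| "loop_free (NStore a e) \<longleftrightarrow> True"
| "loop_free (RStore a e) \<longleftrightarrow> True"
| "loop_free (SampleP a) \<longleftrightarrow> True"
| "loop_free (SampleQ a) \<longleftrightarrow> True"
| "loop_free (Flip a) \<longleftrightarrow> True"
| "loop_free (Seq c d) \<longleftrightarrow> loop_free c \<and> loop_free d"
| "loop_free (Cond t c d) \<longleftrightarrow> loop_free c \<and> loop_free d"
| "loop_free (Loop t c) \<longleftrightarrow> False"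

primrec cost :: "com \<Rightarrow> nat" where
  "cost Skip = 0"
| "cost (NStore a e) = 1"
| "cost (RStore a e) = 1"
| "cost (SampleP a) = 1"
| "cost (SampleQ a) = 1"
| "cost (Flip a) = 1"
| "cost (Seq c d) = cost c + 1 + cost d"
| "cost (Cond t c d) = Suc (max (cost c) (cost d))"
| "cost (Loop t c) = 0"

text \<open>Big-step meaning with every tick included, in a form that the simplifier can execute
  symbolically; loop bodies are verified through it.\<close>

primrec den :: "com \<Rightarrow> state \<Rightarrow> state pmf" where
  "den Skip s = return_pmf s"
| "den (NStore a e) s = return_pmf (tk (nput (nval a s) (nval e s) s))"
| "den (RStore a e) s = return_pmf (tk (rput (nval a s) (rval e s) s))"
| "den (SampleP a) s = p \<bind> (\<lambda>x. return_pmf (tk (nput (nval a s) x (s\<lparr>used_p := used_p s + 1\<rparr>))))"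
| "den (SampleQ a) s = q \<bind> (\<lambda>x. return_pmf (tk (nput (nval a s) x (s\<lparr>used_q := used_q s + 1\<rparr>))))"
| "den (Flip a) s = bernoulli_pmf (1/2) \<bind> (\<lambda>b. return_pmf (tk (nput (nval a s) (of_bool b) s)))"
| "den (Seq c d) s = den c s \<bind> (\<lambda>s'. den d (tk s'))"
| "den (Cond t c d) s = (if tval t s then den c (tk s) else den d (tk s))"
| "den (Loop t c) s = return_pmf s"

lemma halts_loop_free:
  assumes "loop_free c"
  shows "halts (cost c) c s \<and> out (cost c) c s = den c s"
  using assms
proof (induction c arbitrary: s)
  case Skip
  show ?case using haltsI[of 0 Skip s "return_pmf s"] by simp
next
  case (Seq c d)
  then show ?case using halts_Seq[of "cost c" c s "cost d" d] by simp
next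
  case (Cond t c d)
  let ?c = "if tval t s then c else d"
  have "halts (cost ?c) ?c (tk s)" "out (cost ?c) ?c (tk s) = den ?c (tk s)"
    using Cond by auto
  moreover have "cost ?c \<le> max (cost c) (cost d)" by simp
  ultimately have "halts (max (cost c) (cost d)) ?c (tk s)"
    "out (max (cost c) (cost d)) ?c (tk s) = den ?c (tk s)"
    using halts_mono by metis+
  then show ?case using halts_Cond by auto
next
  case (NStore a e)
  have "run p q T (NStore a e, s) = map_pmf (Pair Skip) (den (NStore a e) s)" if "1 \<le> T" for T
    using that by (cases T) (auto simp: bind_return_pmf)
  from haltsI[OF this] show ?case by simp
next
  case (RStore a e)
  have "run p q T (RStore a e, s) = map_pmf (Pair Skip) (den (RStore a e) s)" if "1 \<le> T" for T
    using that by (cases T) (auto simp: bind_return_pmf)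
  from haltsI[OF this] show ?case by simp
next
  case (SampleP a)
  have "run p q T (SampleP a, s) = map_pmf (Pair Skip) (den (SampleP a) s)" if "1 \<le> T" for T
    using that by (cases T) (auto simp: bind_map_pmf map_bind_pmf)
  from haltsI[OF this] show ?case by simp
next
  case (SampleQ a)
  have "run p q T (SampleQ a, s) = map_pmf (Pair Skip) (den (SampleQ a) s)" if "1 \<le> T" for T
    using that by (cases T) (auto simp: bind_map_pmf map_bind_pmf)
  from haltsI[OF this] show ?case by simp
next
  case (Flip a)
  have "run p q T (Flip a, s) = map_pmf (Pair Skip) (den (Flip a) s)" if "1 \<le> T" for T
    using that by (cases T) (auto simp: bind_map_pmf map_bind_pmf)
  from haltsI[OF this] show ?case by simp
qed simp

text \<open>A coupling of an abstract draw with the final state: probabilities computed for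
  \<open>M\<close> carry over to the program without a description of the distribution of its whole
  memory.\<close>

definition simulates :: "nat \<Rightarrow> com \<Rightarrow> state \<Rightarrow> 'a pmf \<Rightarrow> ('a \<Rightarrow> state \<Rightarrow> bool) \<Rightarrow> bool" where
  "simulates B c s M R \<longleftrightarrow> halts B c s \<and> rel_pmf R M (out B c s)"

lemma simulates_mono:
  assumes "simulates B c s M R" "B \<le> B'" "\<And>a s'. R a s' \<Longrightarrow> R' a s'"
  shows "simulates B' c s M R'"
  using assms halts_mono[of B c s B'] unfolding simulates_def
  by (auto intro: pmf.rel_mono_strong)

lemma simulates_loop_free:
  "loop_free c \<Longrightarrow> rel_pmf R M (den c s) \<Longrightarrow> simulates (cost c) c s M R"
  using halts_loop_free[of c s] by (simp add: simulates_def)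

lemma simulates_Seq:
  assumes c: "simulates B c s M R"
    and d: "\<And>a s'. R a s' \<Longrightarrow> simulates B' d (tk s') (K a) R'"
  shows "simulates (B + 1 + B') (Seq c d) s (M \<bind> K) R'"
proof -
  have hc: "halts B c s" and rc: "rel_pmf R M (out B c s)"
    using c by (simp_all add: simulates_def)
  have hd: "halts B' d (tk s')" if "s' \<in> set_pmf (out B c s)" for s'
    using rel_setD2[OF rel_pmf_imp_rel_set[OF rc] that] d by (auto simp: simulates_def)
  have "rel_pmf R' (M \<bind> K) (out B c s \<bind> (\<lambda>s'. out B' d (tk s')))"
    using rc by (rule rel_pmf_bindI) (use d in \<open>simp add: simulates_def\<close>)
  then show ?thesis
    using halts_Seq[OF hc hd] by (simp add: simulates_def)
qed

text \<open>The invariant is indexed by the outcomes drawn so far and the number of remaining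
  rounds. A round costs two steps beyond the body, for the test and for dropping
  \<open>Skip\<close>; the failing test at the end adds one, whence the final
  \<open>tk\<close>.\<close>

lemma simulates_Loop:
  assumes body: "loop_free c"
    and step: "\<And>zs j s. Inv zs (Suc j) s \<Longrightarrow>
      tval t s \<and> rel_pmf (\<lambda>z s'. Inv (zs @ [z]) j (tk s')) K (den c (tk s))"
    and stop: "\<And>zs s. Inv zs 0 s \<Longrightarrow> \<not> tval t s"
    and init: "Inv zs j s"
  shows "simulates (j * (cost c + 2) + 1) (Loop t c) s (replicate_pmf j K)
    (\<lambda>zs' s'. \<exists>s0. Inv (zs @ zs') 0 s0 \<and> s' = tk s0)"
  using init
proof (induction j arbitrary: zs s)
  case 0
  then show ?case
    using halts_Loop_end[OF stop[OF 0], of c] by (auto simp: simulates_def)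
next
  case (Suc j)
  let ?R = "\<lambda>zs zs' s'. \<exists>s0. Inv (zs @ zs') 0 s0 \<and> s' = tk s0"
  note st = step[OF Suc.prems]
  have "simulates (cost c + 1 + (j * (cost c + 2) + 1)) (Seq c (Loop t c)) (tk s)
      (K \<bind> (\<lambda>z. replicate_pmf j K \<bind> (\<lambda>zs'. return_pmf (z # zs')))) (?R zs)"
  proof (rule simulates_Seq)
    show "simulates (cost c) c (tk s) K (\<lambda>z s'. Inv (zs @ [z]) j (tk s'))"
      using body st by (intro simulates_loop_free) auto
    fix z s' assume "Inv (zs @ [z]) j (tk s')"
    from Suc.IH[OF this]
    have h: "halts (j * (cost c + 2) + 1) (Loop t c) (tk s')"
      and r: "rel_pmf (?R (zs @ [z])) (replicate_pmf j K) (out (j * (cost c + 2) + 1) (Loop t c) (tk s'))"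
      by (simp_all add: simulates_def)
    have "rel_pmf (?R zs) (map_pmf (Cons z) (replicate_pmf j K))
        (out (j * (cost c + 2) + 1) (Loop t c) (tk s'))"
      using r by (simp add: pmf.rel_map)
    then show "simulates (j * (cost c + 2) + 1) (Loop t c) (tk s')
        (replicate_pmf j K \<bind> (\<lambda>zs'. return_pmf (z # zs'))) (?R zs)"
      using h by (simp add: simulates_def map_pmf_def)
  qed
  then have "simulates (Suc (cost c + 1 + (j * (cost c + 2) + 1))) (Loop t c) s
      (replicate_pmf (Suc j) K) (?R zs)"
    using st halts_Loop_step[of t s _ c] by (simp add: simulates_def)
  then show ?case by (simp add: algebra_simps)
qed

end

section \<open>The program\<close>

text \<open>Natural-number registers: 0 holds \<open>n\<close> and the verdict, 1 the batch size, 2 the loop counter,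
  3 and 4 the current pair of samples, 5 a coin, and \<open>10 + i\<close> the count of \<open>i\<close>. Real registers: 0 holds
  \<open>\<epsilon>\<close>, 1 and 2 the two statistics, and \<open>10 + i\<close> the signed count of \<open>i\<close>.\<close>

abbreviation "NReg k \<equiv> NLoad (NConst k)"
abbreviation "RReg k \<equiv> RLoad (NConst k)"
abbreviation "slot x \<equiv> NAdd (NConst 10) (NReg x)"
abbreviation "RPow2 e \<equiv> RMul e e"
abbreviation "RPow4 e \<equiv> RMul (RPow2 e) (RPow2 e)"

text \<open>Up to roots, \<open>m \<ge> 10000000 * n^(3/4) * ln (m + 1) / \<epsilon>\<close> and
  \<open>m \<ge> 320 * (ln (m + 1))^2 / \<epsilon>^2\<close>, as \<open>log_mean_large\<close> and
  \<open>log_stat_le\<close> demand. Fourth powers keep it testable with field operations and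
  \<open>ln\<close>.\<close>

definition large_enough :: "nat \<Rightarrow> real \<Rightarrow> nat \<Rightarrow> bool" where
  "large_enough n \<epsilon> m \<longleftrightarrow>
    (10000000 * ln (real m + 1)) ^ 4 * real n ^ 3 \<le> (\<epsilon> * real m) ^ 4 \<and>
    320 * (ln (real m + 1))\<^sup>2 \<le> \<epsilon>\<^sup>2 * real m"

definition too_small :: test where
  "too_small =
    (let n = RNat (NReg 0); m = RNat (NReg 1); l = RLn (RNat (NAdd (NReg 1) (NConst 1))); \<epsilon> = RReg 0
     in Neg (Conj
       (Neg (RLess (RPow4 (RMul \<epsilon> m))
          (RMul (RPow4 (RMul (RNat (NConst 10000000)) l)) (RMul n (RPow2 n)))))
       (Neg (RLess (RMul (RPow2 \<epsilon>) m) (RMul (RNat (NConst 320)) (RPow2 l))))))"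

definition countdown :: com where
  "countdown = NStore (NConst 2) (NSub (NReg 2) (NConst 1))"

definition repeat :: "com \<Rightarrow> com" where
  "repeat c = Seq (NStore (NConst 2) (NReg 1)) (Loop (NLess (NConst 0) (NReg 2)) (Seq c countdown))"

definition sample_pair :: com where
  "sample_pair = Seq (SampleP (NConst 3)) (SampleQ (NConst 4))"

text \<open>Both sources are sampled and one draw is discarded, so that the number of samples from
  each source does not depend on the coins.\<close>

definition count_mix :: com where
  "count_mix = Seq sample_pair (Seq (Flip (NConst 5))
    (Cond (NLess (NConst 0) (NReg 5))
      (NStore (slot 3) (NAdd (NLoad (slot 3)) (NConst 1)))
      (NStore (slot 4) (NAdd (NLoad (slot 4)) (NConst 1)))))"

definition count_signed :: com where
  "count_signed = Seq sample_pair (Seq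
    (RStore (slot 3) (RAdd (RLoad (slot 3)) (RNat (NConst 1))))
    (RStore (slot 4) (RSub (RLoad (slot 4)) (RNat (NConst 1)))))"

definition update_stats :: com where
  "update_stats =
    (let c = (\<lambda>x. RNat (NAdd (NLoad (slot x)) (NConst 1)))
     in Seq sample_pair (Seq
      (RStore (NConst 1) (RAdd (RReg 1)
        (RSub (RDiv (RLoad (slot 3)) (c 3)) (RDiv (RLoad (slot 4)) (c 4)))))
      (RStore (NConst 2) (RAdd (RReg 2) (RSub (RLn (c 3)) (RLn (c 4)))))))"

definition decide :: com where
  "decide = Cond (Conj
      (Neg (RLess (RMul (RNat (NConst 640)) (RNat (NReg 0))) (RPow2 (RReg 1))))
      (Neg (RLess (RPow2 (RDiv (RMul (RNat (NReg 1)) (RReg 0)) (RNat (NConst 4)))) (RPow2 (RReg 2)))))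
    (NStore (NConst 0) (NConst 1)) (NStore (NConst 0) (NConst 0))"

definition find_size :: com where
  "find_size = Seq (NStore (NConst 1) (NConst 1))
    (Loop too_small (NStore (NConst 1) (NAdd (NReg 1) (NConst 1))))"

definition entropy_tester :: com where
  "entropy_tester = Seq find_size (Seq (repeat count_mix) (Seq (repeat count_signed)
    (Seq (repeat update_stats) decide)))"

lemma tval_too_small:
  "tval too_small s \<longleftrightarrow> \<not> large_enough (nmem s 0) (rmem s 0) (nmem s 1)"
proof -
  have "real (nmem s (Suc 0) + 1) = real (nmem s (Suc 0)) + 1" by simp
  then show ?thesis
    unfolding too_small_def large_enough_def Let_def
    by (simp add: power2_eq_square power3_eq_cube power4_eq_xxxx mult.assoc not_less add.commute)
qed

text \<open>The coin commutes with the two draws, and the draw that is not selected integrates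
  out.\<close>

lemma mix_eq:
  "mix p q = bind_pmf p (\<lambda>x. bind_pmf q (\<lambda>y.
    bind_pmf (bernoulli_pmf (1/2)) (\<lambda>b. return_pmf (if b then x else y))))"
proof -
  have "bind_pmf p (\<lambda>x. bind_pmf q (\<lambda>y.
      bind_pmf (bernoulli_pmf (1/2)) (\<lambda>b. return_pmf (if b then x else y)))) =
    bind_pmf p (\<lambda>x. bind_pmf (bernoulli_pmf (1/2)) (\<lambda>b.
      bind_pmf q (\<lambda>y. return_pmf (if b then x else y))))"
    by (subst bind_commute_pmf) (rule refl)
  also have "\<dots> = bind_pmf (bernoulli_pmf (1/2)) (\<lambda>b. bind_pmf p (\<lambda>x.
      bind_pmf q (\<lambda>y. return_pmf (if b then x else y))))"
    by (rule bind_commute_pmf)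
  also have "\<dots> = mix p q"
    unfolding mix_def by (intro bind_pmf_cong refl) (auto simp: bind_return_pmf')
  finally show ?thesis ..
qed

lemma rel_pmf_bind_same:
  "(\<And>x. x \<in> set_pmf M \<Longrightarrow> rel_pmf R (f x) (g x)) \<Longrightarrow> rel_pmf R (M \<bind> f) (M \<bind> g)"
  by (rule rel_pmf_bindI[of "\<lambda>x y. x = y \<and> x \<in> set_pmf M"]) (auto intro: rel_pmf_reflI)

lemma replicate_return_pmf: "replicate_pmf k (return_pmf x) = return_pmf (replicate k x)"
  by (induction k) (simp_all add: bind_return_pmf)

section \<open>Coupling of the program with the abstract tester\<close>

locale entropy_machine = two_sources + machine +
  fixes \<epsilon> :: real
  assumes large: "large_enough n \<epsilon> m"
    and least: "\<And>k. 1 \<le> k \<Longrightarrow> k < m \<Longrightarrow> \<not> large_enough n \<epsilon> k"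
begin

definition ready :: "nat \<Rightarrow> nat \<Rightarrow> state \<Rightarrow> bool" where
  "ready k t s \<longleftrightarrow> nmem s 0 = n \<and> nmem s 1 = m \<and> rmem s 0 = \<epsilon> \<and>
    used_p s = k \<and> used_q s = k \<and> steps s \<le> t"

text \<open>Of the 20 steps budgeted per round, one is the loop test, 16 are left to
  \<open>c\<close>, and three pay for \<open>countdown\<close> and the sequencing steps before and
  after it. The offset 2 in \<open>init\<close> covers storing the counter and moving on to the
  loop.\<close>

lemma repeat_simulates:
  assumes "loop_free c"
    and step: "\<And>zs s. ready (k + length zs) (t + 20 * length zs + 1) s \<Longrightarrow> A zs s \<Longrightarrow>
      rel_pmf (\<lambda>z s'. A (zs @ [z]) s' \<and> nmem s' 2 = nmem s 2 \<and>
         ready (k + length zs + 1) (t + 20 * length zs + 17) s') K (den c s)"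
    and inv: "\<And>zs s v. A zs (nput 2 v s) = A zs s" "\<And>zs s. A zs (tk s) = A zs s"
    and init: "ready k (t - 2) s" "2 \<le> t" "A [] s"
  shows "simulates (m * (cost c + 4) + 3) (repeat c) s (replicate_pmf m K)
    (\<lambda>zs s'. A zs s' \<and> ready (k + m) (t + 20 * m + 1) s')"
proof -
  define Inv where "Inv zs j s \<longleftrightarrow> A zs s \<and> nmem s 2 = j \<and> length zs + j = m \<and>
    ready (k + length zs) (t + 20 * length zs) s" for zs j s
  let ?loop = "Loop (NLess (NConst 0) (NReg 2)) (Seq c countdown)"
  let ?body = "Seq c countdown"
  have loop: "simulates (m * (cost ?body + 2) + 1) ?loop s (replicate_pmf m K)
    (\<lambda>zs' s'. \<exists>s0. Inv ([] @ zs') 0 s0 \<and> s' = tk s0)" if "Inv [] m s" for s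
  proof (rule simulates_Loop)
    show "loop_free ?body" using assms(1) by (simp add: countdown_def)
    show "\<not> tval (NLess (NConst 0) (NReg 2)) s" if "Inv zs 0 s" for zs s
      using that by (simp add: Inv_def)
    show "tval (NLess (NConst 0) (NReg 2)) s \<and>
        rel_pmf (\<lambda>z s'. Inv (zs @ [z]) j (tk s')) K (den ?body (tk s))" if I: "Inv zs (Suc j) s" for zs j s
    proof
      show "tval (NLess (NConst 0) (NReg 2)) s" using I by (simp add: Inv_def)
      have "rel_pmf (\<lambda>z s'. A (zs @ [z]) s' \<and> nmem s' 2 = nmem (tk s) 2 \<and>
         ready (k + length zs + 1) (t + 20 * length zs + 17) s') K (den c (tk s))"
        using I inv by (intro step) (auto simp: Inv_def ready_def)
      then have "rel_pmf (\<lambda>z s'. Inv (zs @ [z]) j (tk s'))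
          (K \<bind> return_pmf) (den c (tk s) \<bind> (\<lambda>s'. den countdown (tk s')))"
      proof (rule rel_pmf_bindI)
        fix z s'
        assume "A (zs @ [z]) s' \<and> nmem s' 2 = nmem (tk s) 2 \<and>
          ready (k + length zs + 1) (t + 20 * length zs + 17) s'"
        then show "rel_pmf (\<lambda>z s'. Inv (zs @ [z]) j (tk s')) (return_pmf z) (den countdown (tk s'))"
          using I by (auto simp: Inv_def ready_def countdown_def inv)
      qed
      then show "rel_pmf (\<lambda>z s'. Inv (zs @ [z]) j (tk s')) K (den ?body (tk s))"
        by (simp add: bind_return_pmf')
    qed
  qed (rule that)
  have "simulates (cost (NStore (NConst 2) (NReg 1)) + 1 + (m * (cost ?body + 2) + 1)) (repeat c) s
      (return_pmf () \<bind> (\<lambda>_. replicate_pmf m K)) (\<lambda>zs' s'. \<exists>s0. Inv ([] @ zs') 0 s0 \<and> s' = tk s0)"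
    unfolding repeat_def
  proof (rule simulates_Seq)
    show "simulates (cost (NStore (NConst 2) (NReg 1))) (NStore (NConst 2) (NReg 1)) s
        (return_pmf ()) (\<lambda>_ s'. Inv [] m (tk s'))"
      using init by (intro simulates_loop_free) (auto simp: Inv_def ready_def inv)
  qed (rule loop)
  from this[unfolded bind_return_pmf] show ?thesis
    by (rule simulates_mono) (auto simp: Inv_def ready_def countdown_def inv algebra_simps)
qed

text \<open>The search is deterministic, so its abstract counterpart draws units:
  \<open>m - 1\<close> tests ask for more by \<open>least\<close>, and the next one stops by
  \<open>large\<close>.\<close>

lemma find_size_simulates:
  "simulates (3 * m + 3) find_size (start n \<epsilon>) (return_pmf ())
    (\<lambda>_ s. ready 0 (4 * m + 4) s \<and> (\<forall>i. nmem s (10 + i) = 0) \<and> (\<forall>i. i \<noteq> 0 \<longrightarrow> rmem s i = 0))"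
proof -
  define Inv where "Inv zs j s \<longleftrightarrow> nmem s 0 = n \<and> 1 \<le> nmem s 1 \<and> nmem s 1 + j = m \<and>
    rmem s 0 = \<epsilon> \<and> used_p s = 0 \<and> used_q s = 0 \<and> length zs + j = m - 1 \<and>
    steps s \<le> 2 + 3 * length zs \<and> (\<forall>i. nmem s (10 + i) = 0) \<and> (\<forall>i. i \<noteq> 0 \<longrightarrow> rmem s i = 0)"
    for zs :: "unit list" and j and s :: state
  let ?inc = "NStore (NConst 1) (NAdd (NReg 1) (NConst 1))"
  have loop: "simulates ((m - 1) * (cost ?inc + 2) + 1) (Loop too_small ?inc) s
    (replicate_pmf (m - 1) (return_pmf ())) (\<lambda>zs' s'. \<exists>s0. Inv ([] @ zs') 0 s0 \<and> s' = tk s0)"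
    if "Inv [] (m - 1) s" for s
  proof (rule simulates_Loop)
    show "\<not> tval too_small s" if "Inv zs 0 s" for zs s
      using that large by (simp add: Inv_def tval_too_small)
    show "tval too_small s \<and> rel_pmf (\<lambda>z s'. Inv (zs @ [z]) j (tk s')) (return_pmf ()) (den ?inc (tk s))"
      if "Inv zs (Suc j) s" for zs j s
      using that least[of "nmem s 1"] by (auto simp: Inv_def tval_too_small)
  qed (use that in simp_all)
  have "simulates (cost (NStore (NConst 1) (NConst 1)) + 1 + ((m - 1) * (cost ?inc + 2) + 1)) find_size
      (start n \<epsilon>) (return_pmf () \<bind> (\<lambda>_. replicate_pmf (m - 1) (return_pmf ())))
      (\<lambda>zs' s'. \<exists>s0. Inv ([] @ zs') 0 s0 \<and> s' = tk s0)"
    unfolding find_size_def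
  proof (rule simulates_Seq)
    show "simulates (cost (NStore (NConst 1) (NConst 1))) (NStore (NConst 1) (NConst 1)) (start n \<epsilon>)
        (return_pmf ()) (\<lambda>_ s'. Inv [] (m - 1) (tk s'))"
      using m by (intro simulates_loop_free) (auto simp: Inv_def start_def)
  qed (rule loop)
  then have "simulates (3 * m + 3) find_size (start n \<epsilon>)
      (return_pmf () \<bind> (\<lambda>_. replicate_pmf (m - 1) (return_pmf ())))
      (\<lambda>_ s. ready 0 (4 * m + 4) s \<and> (\<forall>i. nmem s (10 + i) = 0) \<and> (\<forall>i. i \<noteq> 0 \<longrightarrow> rmem s i = 0))"
    by (rule simulates_mono) (auto simp: Inv_def ready_def)
  then show ?thesis
    by (simp add: simulates_def bind_return_pmf replicate_return_pmf rel_pmf_return_pmf1)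
qed

definition counted :: "nat list \<Rightarrow> state \<Rightarrow> bool" where
  "counted xs s \<longleftrightarrow> (\<forall>i. nmem s (10 + i) = count_list xs i) \<and> (\<forall>i. i \<noteq> 0 \<longrightarrow> rmem s i = 0)"

definition tallied :: "nat list \<Rightarrow> (nat \<times> nat) list \<Rightarrow> (nat \<times> nat) list \<Rightarrow> state \<Rightarrow> bool" where
  "tallied xs us vs s \<longleftrightarrow> (\<forall>i. nmem s (10 + i) = count_list xs i) \<and>
    (\<forall>i. rmem s (10 + i) = (\<Sum>u\<leftarrow>us. signed u i)) \<and>
    rmem s 1 = l2_stat xs us vs \<and> rmem s 2 = log_stat xs vs"

lemma count_mix_simulates:
  assumes "ready 0 (t - 2) s" "2 \<le> t" "counted [] s"
  shows "simulates (m * (cost count_mix + 4) + 3) (repeat count_mix) s Xs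
    (\<lambda>xs s'. counted xs s' \<and> ready m (t + 20 * m + 1) s')"
proof -
  have "simulates (m * (cost count_mix + 4) + 3) (repeat count_mix) s (replicate_pmf m (mix p q))
    (\<lambda>xs s'. counted xs s' \<and> ready (0 + m) (t + 20 * m + 1) s')"
  proof (rule repeat_simulates)
    fix zs s assume "ready (0 + length zs) (t + 20 * length zs + 1) s" "counted zs s"
    then show "rel_pmf (\<lambda>z s'. counted (zs @ [z]) s' \<and> nmem s' 2 = nmem s 2 \<and>
        ready (0 + length zs + 1) (t + 20 * length zs + 17) s') (mix p q) (den count_mix s)"
      unfolding mix_eq count_mix_def sample_pair_def
      by (simp add: bind_assoc_pmf bind_return_pmf, intro rel_pmf_bind_same)
        (auto simp: counted_def ready_def)
  qed (use assms in \<open>auto simp: count_mix_def sample_pair_def counted_def\<close>)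
  then show ?thesis by (simp add: Xs_def)
qed

text \<open>Besides the signed counts this sets up the last phase: registers 1 and 2 are still zero,
  which is the value of both statistics on an empty batch.\<close>

lemma count_signed_simulates:
  assumes "ready m (t - 2) s" "2 \<le> t" "counted xs s"
  shows "simulates (m * (cost count_signed + 4) + 3) (repeat count_signed) s Us
    (\<lambda>us s'. tallied xs us [] s' \<and> ready (2 * m) (t + 20 * m + 1) s')"
proof -
  have "simulates (m * (cost count_signed + 4) + 3) (repeat count_signed) s
    (replicate_pmf m (pair_pmf p q)) (\<lambda>us s'. tallied xs us [] s' \<and> ready (m + m) (t + 20 * m + 1) s')"
  proof (rule repeat_simulates)
    fix zs s assume "ready (m + length zs) (t + 20 * length zs + 1) s" "tallied xs zs [] s"
    then show "rel_pmf (\<lambda>z s'. tallied xs (zs @ [z]) [] s' \<and> nmem s' 2 = nmem s 2 \<and>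
        ready (m + length zs + 1) (t + 20 * length zs + 17) s') (pair_pmf p q) (den count_signed s)"
      unfolding pair_pmf_def count_signed_def sample_pair_def
      by (simp add: bind_assoc_pmf bind_return_pmf, intro rel_pmf_bind_same)
        (auto simp: tallied_def ready_def signed_def l2_stat_def log_stat_def)
  qed (use assms in \<open>auto simp: count_signed_def sample_pair_def counted_def tallied_def l2_stat_def log_stat_def\<close>)
  then show ?thesis by (simp add: Us_def PQ_def mult_2)
qed

lemma update_stats_simulates:
  assumes "ready (2 * m) (t - 2) s" "2 \<le> t" "tallied xs us [] s"
  shows "simulates (m * (cost update_stats + 4) + 3) (repeat update_stats) s Us
    (\<lambda>vs s'. tallied xs us vs s' \<and> ready (3 * m) (t + 20 * m + 1) s')"
proof -
  have "simulates (m * (cost update_stats + 4) + 3) (repeat update_stats) s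
    (replicate_pmf m (pair_pmf p q))
    (\<lambda>vs s'. tallied xs us vs s' \<and> ready (2 * m + m) (t + 20 * m + 1) s')"
  proof (rule repeat_simulates)
    fix zs s assume "ready (2 * m + length zs) (t + 20 * length zs + 1) s" "tallied xs us zs s"
    then show "rel_pmf (\<lambda>z s'. tallied xs us (zs @ [z]) s' \<and> nmem s' 2 = nmem s 2 \<and>
        ready (2 * m + length zs + 1) (t + 20 * length zs + 17) s') (pair_pmf p q) (den update_stats s)"
      unfolding pair_pmf_def update_stats_def sample_pair_def Let_def
      by (simp add: bind_assoc_pmf bind_return_pmf, intro rel_pmf_bind_same)
        (auto simp: tallied_def ready_def diff_def weight_def log_count_def l2_stat_def log_stat_def add.commute)
  qed (use assms in \<open>auto simp: update_stats_def sample_pair_def tallied_def Let_def\<close>)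
  then show ?thesis by (simp add: Us_def PQ_def)
qed

lemma decide_simulates:
  assumes "tallied xs us vs s" "ready (3 * m) t s"
  shows "simulates (cost decide) decide s (return_pmf (verdict n \<epsilon> m xs us vs))
    (\<lambda>b s. nmem s 0 = of_bool b \<and> used_p s = 3 * m \<and> used_q s = 3 * m \<and> steps s \<le> t + 2)"
  using assms
  by (intro simulates_loop_free)
     (auto simp: decide_def tallied_def ready_def verdict_def power2_eq_square not_less)

lemma ready_tk: "ready k t s \<Longrightarrow> ready k (Suc t) (tk s)"
  and counted_tk: "counted xs s \<Longrightarrow> counted xs (tk s)"
  and tallied_tk: "tallied xs us vs s \<Longrightarrow> tallied xs us vs (tk s)"
  by (simp_all add: ready_def counted_def tallied_def)

definition finished :: "bool \<Rightarrow> state \<Rightarrow> bool" where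
  "finished b s \<longleftrightarrow> nmem s 0 = of_bool b \<and> used_p s = 3 * m \<and> used_q s = 3 * m \<and> steps s \<le> 100 * m"

lemma entropy_tester_simulates:
  "\<exists>B. simulates B entropy_tester (start n \<epsilon>) (tester n \<epsilon> m p q) finished"
proof -
  \<comment> \<open>Time budgets, sequencing included: \<open>4 * m + 5\<close> after the search,
    \<open>20 * m + 4\<close> for each batch, and 2 for the decision; the sum
    \<open>64 * m + 19\<close> is at most \<open>100 * m\<close> as
    \<open>m \<ge> 1\<close>.\<close>
  let ?B1 = "m * (cost update_stats + 4) + 3 + 1 + cost decide"
  have 1: "simulates ?B1 (Seq (repeat update_stats) decide) s
      (Us \<bind> (\<lambda>vs. return_pmf (verdict n \<epsilon> m xs us vs))) finished"
    if s: "ready (2 * m) (44 * m + 13) s" "tallied xs us [] s" for xs us s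
  proof (rule simulates_Seq)
    show "simulates (m * (cost update_stats + 4) + 3) (repeat update_stats) s Us
        (\<lambda>vs s'. tallied xs us vs s' \<and> ready (3 * m) (44 * m + 15 + 20 * m + 1) s')"
      by (rule update_stats_simulates) (use s in \<open>simp_all add: ready_def\<close>)
    fix vs s' assume "tallied xs us vs s' \<and> ready (3 * m) (44 * m + 15 + 20 * m + 1) s'"
    then have "simulates (cost decide) decide (tk s') (return_pmf (verdict n \<epsilon> m xs us vs))
      (\<lambda>b s. nmem s 0 = of_bool b \<and> used_p s = 3 * m \<and> used_q s = 3 * m \<and>
        steps s \<le> Suc (44 * m + 15 + 20 * m + 1) + 2)"
      by (intro decide_simulates[of xs us] ready_tk tallied_tk) auto
    then show "simulates (cost decide) decide (tk s') (return_pmf (verdict n \<epsilon> m xs us vs)) finished"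
      by (rule simulates_mono) (use m in \<open>auto simp: finished_def\<close>)
  qed
  let ?B2 = "m * (cost count_signed + 4) + 3 + 1 + ?B1"
  have 2: "simulates ?B2 (Seq (repeat count_signed) (Seq (repeat update_stats) decide)) s
      (Us \<bind> (\<lambda>us. Us \<bind> (\<lambda>vs. return_pmf (verdict n \<epsilon> m xs us vs)))) finished"
    if s: "ready m (24 * m + 9) s" "counted xs s" for xs s
  proof (rule simulates_Seq)
    show "simulates (m * (cost count_signed + 4) + 3) (repeat count_signed) s Us
        (\<lambda>us s'. tallied xs us [] s' \<and> ready (2 * m) (24 * m + 11 + 20 * m + 1) s')"
      by (rule count_signed_simulates) (use s in \<open>simp_all add: ready_def\<close>)
    fix us s' assume "tallied xs us [] s' \<and> ready (2 * m) (24 * m + 11 + 20 * m + 1) s'"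
    then show "simulates ?B1 (Seq (repeat update_stats) decide) (tk s')
        (Us \<bind> (\<lambda>vs. return_pmf (verdict n \<epsilon> m xs us vs))) finished"
      using ready_tk[of "2 * m" "24 * m + 11 + 20 * m + 1" s'] by (intro 1 tallied_tk) (auto simp: ready_def)
  qed
  let ?B3 = "m * (cost count_mix + 4) + 3 + 1 + ?B2"
  have 3: "simulates ?B3
      (Seq (repeat count_mix) (Seq (repeat count_signed) (Seq (repeat update_stats) decide))) s
      (Xs \<bind> (\<lambda>xs. Us \<bind> (\<lambda>us. Us \<bind> (\<lambda>vs. return_pmf (verdict n \<epsilon> m xs us vs))))) finished"
    if s: "ready 0 (4 * m + 5) s" "counted [] s" for s
  proof (rule simulates_Seq)
    show "simulates (m * (cost count_mix + 4) + 3) (repeat count_mix) s Xs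
        (\<lambda>xs s'. counted xs s' \<and> ready m (4 * m + 7 + 20 * m + 1) s')"
      by (rule count_mix_simulates) (use s in \<open>simp_all add: ready_def\<close>)
    fix xs s' assume "counted xs s' \<and> ready m (4 * m + 7 + 20 * m + 1) s'"
    then show "simulates ?B2 (Seq (repeat count_signed) (Seq (repeat update_stats) decide)) (tk s')
        (Us \<bind> (\<lambda>us. Us \<bind> (\<lambda>vs. return_pmf (verdict n \<epsilon> m xs us vs)))) finished"
      using ready_tk[of m "4 * m + 7 + 20 * m + 1" s'] by (intro 2 counted_tk) (auto simp: ready_def)
  qed
  have "simulates (3 * m + 3 + 1 + ?B3) entropy_tester (start n \<epsilon>)
      (return_pmf () \<bind> (\<lambda>_. Xs \<bind> (\<lambda>xs. Us \<bind> (\<lambda>us.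
        Us \<bind> (\<lambda>vs. return_pmf (verdict n \<epsilon> m xs us vs)))))) finished"
    unfolding entropy_tester_def
  proof (rule simulates_Seq[OF find_size_simulates])
    fix s
    assume "ready 0 (4 * m + 4) s \<and> (\<forall>i. nmem s (10 + i) = 0) \<and> (\<forall>i. i \<noteq> 0 \<longrightarrow> rmem s i = 0)"
    then show "simulates ?B3
        (Seq (repeat count_mix) (Seq (repeat count_signed) (Seq (repeat update_stats) decide))) (tk s)
        (Xs \<bind> (\<lambda>xs. Us \<bind> (\<lambda>us. Us \<bind> (\<lambda>vs. return_pmf (verdict n \<epsilon> m xs us vs))))) finished"
      using ready_tk[of 0 "4 * m + 4" s] by (intro 3 counted_tk) (auto simp: counted_def ready_def)
  qed
  then show ?thesis
    by (auto simp: tester_def Xs_def Us_def PQ_def bind_return_pmf)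
qed

lemma entropy_tester_correct:
  assumes "0 < \<epsilon>" "\<epsilon> \<le> 1 / 2"
  shows "\<exists>T. (\<forall>(c, s) \<in> set_pmf (run p q T (entropy_tester, start n \<epsilon>)).
        c = Skip \<and> used_p s = 3 * m \<and> used_q s = 3 * m \<and> steps s \<le> 100 * m) \<and>
      (p = q \<longrightarrow> measure_pmf.prob (run p q T (entropy_tester, start n \<epsilon>)) accepting \<ge> 9 / 10) \<and>
      (\<bar>shannon_entropy p - shannon_entropy q\<bar> \<ge> \<epsilon> \<longrightarrow>
        measure_pmf.prob (run p q T (entropy_tester, start n \<epsilon>)) rejecting \<ge> 9 / 10)"
proof -
  obtain T where T: "simulates T entropy_tester (start n \<epsilon>) (tester n \<epsilon> m p q) finished"
    using entropy_tester_simulates by blast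
  let ?M = "out T entropy_tester (start n \<epsilon>)"
  have run: "run p q T (entropy_tester, start n \<epsilon>) = map_pmf (Pair Skip) ?M"
    and rel: "rel_pmf finished (tester n \<epsilon> m p q) ?M"
    using T by (auto simp: simulates_def halts_def)
  have fin: "\<exists>b. finished b s" if "s \<in> set_pmf ?M" for s
    using rel_setD2[OF rel_pmf_imp_rel_set[OF rel] that] by blast
  have prob: "measure_pmf.prob (tester n \<epsilon> m p q) {b} \<le>
      measure_pmf.prob (run p q T (entropy_tester, start n \<epsilon>)) {(c, s). c = Skip \<and> nmem s 0 = of_bool b}"
    for b
  proof -
    have "measure_pmf.prob (tester n \<epsilon> m p q) {b} \<le> measure_pmf.prob ?M {s. \<exists>x\<in>{b}. finished x s}"
      by (rule rel_pmf_measureD[OF rel])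
    also have "\<dots> \<le> measure_pmf.prob ?M (Pair Skip -` {(c, s). c = Skip \<and> nmem s 0 = of_bool b})"
      by (rule measure_pmf.finite_measure_mono) (auto simp: finished_def)
    finally show ?thesis by (simp add: run)
  qed
  have c: "(10000000 * ln (real m + 1)) ^ 4 * real n ^ 3 \<le> (\<epsilon> * real m) ^ 4"
    "320 * (ln (real m + 1))\<^sup>2 \<le> \<epsilon>\<^sup>2 * real m"
    using large by (auto simp: large_enough_def)
  show ?thesis
  proof (intro exI conjI impI)
    show "\<forall>(c, s) \<in> set_pmf (run p q T (entropy_tester, start n \<epsilon>)).
        c = Skip \<and> used_p s = 3 * m \<and> used_q s = 3 * m \<and> steps s \<le> 100 * m"
      using fin by (auto simp: run finished_def)
    show "measure_pmf.prob (run p q T (entropy_tester, start n \<epsilon>)) accepting \<ge> 9 / 10" if "p = q"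
      using tester_accepts[OF that assms(1) c(2)] prob[of True] by (simp add: accepting_def)
    show "measure_pmf.prob (run p q T (entropy_tester, start n \<epsilon>)) rejecting \<ge> 9 / 10"
      if "\<bar>shannon_entropy p - shannon_entropy q\<bar> \<ge> \<epsilon>"
      using tester_rejects[OF assms c that] prob[of False] by (simp add: rejecting_def)
  qed
qed

end

text \<open>The condition contains \<open>m\<close> inside a logarithm. A crude polynomial bound on
  \<open>m\<close> in \<open>y = n / \<epsilon>\<close> breaks this circle, giving
  \<open>ln (m + 1) \<le> 36 * L\<close>; then \<open>36 * 10^7\<close> and
  \<open>320 * 36^2\<close> both stay below the factor \<open>10^9\<close>.\<close>

lemma large_enough_bound:
  assumes "1 \<le> n" "0 < \<epsilon>" "\<epsilon> \<le> 1 / 2"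
    and L: "L = ln (real n / \<epsilon>)"
    and X: "X = real n powr (3/4) * L / \<epsilon> + L\<^sup>2 / \<epsilon>\<^sup>2"
    and m: "1000000000 * X \<le> real m" "real m \<le> 1000000000 * X + 1"
  shows "large_enough n \<epsilon> m"
proof -
  define y where "y = real n / \<epsilon>"
  define l where "l = ln (real m + 1)"
  have y2: "2 \<le> y"
  proof -
    have "2 * \<epsilon> \<le> real n" using assms by linarith
    then show ?thesis using assms by (simp add: y_def field_simps)
  qed
  have Ln2: "ln 2 \<le> L" unfolding L y_def[symmetric] using y2 by simp
  have Lpos: "0 < L" using Ln2 ln2_ge_two_thirds by linarith
  have Ly: "L \<le> y" unfolding L y_def[symmetric] using y2 ln_le_minus_one[of y] by simp
  have inv: "1 / \<epsilon> \<le> y" using assms by (simp add: y_def divide_right_mono)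
  have n34: "real n powr (3/4) \<le> real n"
    using assms powr_mono[of "3/4" 1 "real n"] by simp
  have X1: "1 \<le> y ^ 4" using y2 by (simp add: one_le_power)
  have "X \<le> 2 * y ^ 4"
  proof -
    have "real n powr (3/4) * L / \<epsilon> \<le> real n * L / \<epsilon>"
      using n34 Lpos assms by (intro divide_right_mono mult_right_mono) auto
    also have "\<dots> = y * L" by (simp add: y_def)
    also have "\<dots> \<le> y * y" using Ly y2 by (intro mult_left_mono) auto
    also have "\<dots> \<le> y ^ 4" using power_increasing[of 2 4 y] y2 by (simp add: power2_eq_square)
    finally have a: "real n powr (3/4) * L / \<epsilon> \<le> y ^ 4" .
    have "L\<^sup>2 / \<epsilon>\<^sup>2 = (L * (1 / \<epsilon>))\<^sup>2" by (simp add: power_divide)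
    also have "\<dots> \<le> (y * y)\<^sup>2"
      using Ly inv Lpos y2 assms by (intro power_mono mult_mono) auto
    also have "\<dots> = y ^ 4" by (simp add: power4_eq_xxxx power2_eq_square)
    finally show ?thesis using a X by linarith
  qed
  \<comment> \<open>\<open>2 * 10^9 + 2\<close> is below \<open>2^32\<close>; a power of 2 is
    convenient because its logarithm is absorbed through \<open>ln 2 \<le> L\<close>.\<close>
  then have "real m + 1 \<le> 2 ^ 32 * y ^ 4" using m(2) X1 by simp
  moreover have "l = ln (real m + 1)" "0 < real m + 1" by (simp_all add: l_def)
  ultimately have "l \<le> ln (2 ^ 32 * y ^ 4)" by (simp only: ln_mono)
  also have "\<dots> = 32 * ln 2 + 4 * L"
  proof -
    have "ln (2 ^ 32 * y ^ 4) = ln (2 ^ 32 :: real) + ln (y ^ 4)"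
      using y2 by (simp add: ln_mult del: power_numeral)
    then show ?thesis using y2 by (simp add: ln_realpow L y_def[symmetric] del: power_numeral)
  qed
  finally have l: "l \<le> 36 * L" using Ln2 by linarith
  have l0: "0 \<le> l" by (simp add: l_def)
  have n3: "real n ^ 3 = (real n powr (3/4)) ^ 4"
  proof -
    have "(real n powr (3/4)) ^ 4 = real n powr (real 4 * (3/4))"
      using assms by (intro powr_power) auto
    also have "\<dots> = real n ^ 3" using assms powr_realpow[of "real n" 3] by simp
    finally show ?thesis ..
  qed
  have c1: "10000000 * l * real n powr (3/4) \<le> \<epsilon> * real m"
  proof -
    have "10000000 * l * real n powr (3/4) \<le> 10000000 * (36 * L) * real n powr (3/4)"
      using l by (intro mult_right_mono mult_left_mono) auto
    also have "\<dots> \<le> \<epsilon> * (1000000000 * (real n powr (3/4) * L / \<epsilon>))"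
      using assms Lpos by simp
    also have "\<dots> \<le> \<epsilon> * (1000000000 * X)"
      unfolding X using assms by (intro mult_left_mono) auto
    also have "\<dots> \<le> \<epsilon> * real m" using m(1) assms by (intro mult_left_mono) auto
    finally show ?thesis .
  qed
  have c2: "320 * l\<^sup>2 \<le> \<epsilon>\<^sup>2 * real m"
  proof -
    have "320 * l\<^sup>2 \<le> 320 * (36 * L)\<^sup>2"
      using l l0 by (intro mult_left_mono power_mono) auto
    also have "\<dots> \<le> \<epsilon>\<^sup>2 * (1000000000 * (L\<^sup>2 / \<epsilon>\<^sup>2))"
      using assms by (simp add: power_mult_distrib)
    also have "\<dots> \<le> \<epsilon>\<^sup>2 * (1000000000 * X)"
      unfolding X using assms Lpos by (intro mult_left_mono) auto
    also have "\<dots> \<le> \<epsilon>\<^sup>2 * real m" using m(1) assms by (intro mult_left_mono) auto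
    finally show ?thesis .
  qed
  have "(10000000 * l * real n powr (3/4)) ^ 4 \<le> (\<epsilon> * real m) ^ 4"
    using c1 l0 by (intro power_mono) auto
  then show ?thesis
    using c2 unfolding large_enough_def n3 l_def by (simp only: power_mult_distrib)
qed

theorem theorem2p2:
  "\<exists>(alg :: com) (C :: real). C > 0 \<and>
    (\<forall>(n :: nat) (\<epsilon> :: real) (p :: nat pmf) (q :: nat pmf).
      n \<ge> 1 \<longrightarrow> 0 < \<epsilon> \<longrightarrow> \<epsilon> \<le> 1/2 \<longrightarrow> set_pmf p \<subseteq> {1..n} \<longrightarrow> set_pmf q \<subseteq> {1..n} \<longrightarrow>
      (let B = real n powr (3/4) * ln (real n / \<epsilon>) * ln (real n) / \<epsilon>
               + (ln (real n / \<epsilon>))^2 / \<epsilon>^2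
       in \<exists>T :: nat.
         (\<forall>(c, s) \<in> set_pmf (run p q T (alg, start n \<epsilon>)).
            c = Skip \<and>
            real (used_p s) \<le> C * B \<and> real (used_q s) \<le> C * B \<and>
            (let N = real (used_p s + used_q s) in real (steps s) \<le> C * (N * ln N))) \<and>
         (p = q \<longrightarrow>
            measure_pmf.prob (run p q T (alg, start n \<epsilon>)) accepting \<ge> 9/10) \<and>
         (\<bar>shannon_entropy p - shannon_entropy q\<bar> \<ge> \<epsilon> \<longrightarrow>
            measure_pmf.prob (run p q T (alg, start n \<epsilon>)) rejecting \<ge> 9/10)))"
proof (intro exI[of _ entropy_tester] exI[of _ "10000000000 :: real"] conjI allI impI)
  fix n :: nat and \<epsilon> :: real and p q :: "nat pmf"
  assume n: "1 \<le> n" and \<epsilon>: "0 < \<epsilon>" "\<epsilon> \<le> 1 / 2"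
    and supp: "set_pmf p \<subseteq> {1..n}" "set_pmf q \<subseteq> {1..n}"
  define L where "L = ln (real n / \<epsilon>)"
  \<comment> \<open>The order of the sample size that suffices, without the factor
    \<open>ln n\<close> of \<open>B\<close>.\<close>
  define X where "X = real n powr (3/4) * L / \<epsilon> + L\<^sup>2 / \<epsilon>\<^sup>2"
  define B where "B = real n powr (3/4) * L * ln (real n) / \<epsilon> + L\<^sup>2 / \<epsilon>\<^sup>2"
  define m0 where "m0 = nat \<lceil>1000000000 * X\<rceil>"
  have Ln2: "ln 2 \<le> L"
  proof -
    have "2 * \<epsilon> \<le> real n" using n \<epsilon> by linarith
    then have "2 \<le> real n / \<epsilon>" using \<epsilon> by (simp add: field_simps)
    then show ?thesis by (simp add: L_def)
  qed
  then have L23: "2 / 3 \<le> L" using ln2_ge_two_thirds by linarith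
  have n1: "1 \<le> real n powr (3/4)" using n by (simp add: ge_one_powr_ge_zero)
  have X1: "1 \<le> X"
  proof -
    have "1 * L / (1 / 2) \<le> real n powr (3/4) * L / \<epsilon>"
      using n1 L23 \<epsilon> by (intro frac_le mult_right_mono) auto
    then have "2 * L \<le> real n powr (3/4) * L / \<epsilon>" by simp
    then have "1 \<le> real n powr (3/4) * L / \<epsilon>" using L23 by linarith
    moreover have "0 \<le> L\<^sup>2 / \<epsilon>\<^sup>2" by simp
    ultimately show ?thesis unfolding X_def by linarith
  qed
  have m0: "1000000000 * X \<le> real m0" "real m0 \<le> 1000000000 * X + 1"
    using X1 by (simp_all add: m0_def)
  have ok: "large_enough n \<epsilon> m0"
    by (rule large_enough_bound[OF n \<epsilon> L_def X_def m0])
  have m01: "1 \<le> m0" using m0(1) X1 by linarith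
  \<comment> \<open>The condition is known at \<open>m0\<close>, but its monotonicity is not
    established; the least solution is what the search finds, and it is at most
    \<open>m0\<close>.\<close>
  define m where "m = (LEAST k. 1 \<le> k \<and> large_enough n \<epsilon> k)"
  have m: "1 \<le> m \<and> large_enough n \<epsilon> m"
    unfolding m_def by (rule LeastI[of _ m0]) (use m01 ok in blast)
  have least: "\<not> large_enough n \<epsilon> k" if "1 \<le> k" "k < m" for k
    using that not_less_Least[of k "\<lambda>k. 1 \<le> k \<and> large_enough n \<epsilon> k"] by (auto simp: m_def)
  have mm0: "m \<le> m0" unfolding m_def by (rule Least_le) (use m01 ok in blast)
  have XB: "X \<le> 2 * B"
  proof (cases "n = 1")
    case True
    \<comment> \<open>At \<open>n = 1\<close> the factor \<open>ln n\<close> annihilates the first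
      summand of \<open>B\<close>; the second one, a square of a number at least 1, covers the
      missing \<open>L / \<epsilon>\<close>.\<close>
    have "1 \<le> L / \<epsilon>" using L23 \<epsilon> by (simp add: field_simps)
    then have "L / \<epsilon> * 1 \<le> L / \<epsilon> * (L / \<epsilon>)" by (intro mult_left_mono) auto
    then show ?thesis unfolding X_def B_def using True by (simp add: power2_eq_square)
  next
    case False
    have "2 / 3 \<le> ln (real n)"
      using n False ln2_ge_two_thirds ln_mono[of 2 "real n"] by linarith
    then have "real n powr (3/4) * L / \<epsilon> * (2 / 3) \<le> real n powr (3/4) * L / \<epsilon> * ln (real n)"
      using L23 \<epsilon> by (intro mult_left_mono) auto
    also have "\<dots> = real n powr (3/4) * L * ln (real n) / \<epsilon>" by simp
    finally have *: "real n powr (3/4) * L / \<epsilon> * (2 / 3) \<le> real n powr (3/4) * L * ln (real n) / \<epsilon>" .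
    have "u + s \<le> 2 * (r + s)" if "u * (2 / 3) \<le> r" "0 \<le> u" "0 \<le> s" for r s u :: real
      using that by simp
    from this[OF *] show ?thesis unfolding X_def B_def by this (use L23 \<epsilon> in simp_all)
  qed
  \<comment> \<open>Three batches take \<open>3 * m\<close> samples from each source;
    \<open>10^10\<close> exceeds \<open>3 * 2 * 10^9\<close> by enough to absorb the rounding of
    \<open>m0\<close>.\<close>
  have mB: "3 * real m \<le> 10000000000 * B"
  proof -
    have "real m \<le> 1000000000 * X + 1" using mm0 m0(2) by linarith
    then show ?thesis using XB X1 by linarith
  qed
  \<comment> \<open>The time is even linear in the total \<open>6 * m\<close> of samples, whose
    logarithm is at least \<open>2 / 3\<close>.\<close>
  have time: "real t \<le> 10000000000 * (real (3 * m + 3 * m) * ln (real (3 * m + 3 * m)))"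
    if "t \<le> 100 * m" for t
  proof -
    have "ln 2 \<le> ln (real (3 * m + 3 * m))" using m by (intro ln_mono) auto
    then have "2 / 3 \<le> ln (real (3 * m + 3 * m))" using ln2_ge_two_thirds by linarith
    then have "real (3 * m + 3 * m) * (2 / 3) \<le> real (3 * m + 3 * m) * ln (real (3 * m + 3 * m))"
      by (intro mult_left_mono) auto
    moreover have "real t \<le> 100 * real m" using that by linarith
    ultimately show ?thesis by simp
  qed
  interpret entropy_machine n m p q \<epsilon>
    by unfold_locales (use n m supp least in auto)
  show "let B = real n powr (3/4) * ln (real n / \<epsilon>) * ln (real n) / \<epsilon>
               + (ln (real n / \<epsilon>))^2 / \<epsilon>^2
       in \<exists>T :: nat.
         (\<forall>(c, s) \<in> set_pmf (run p q T (entropy_tester, start n \<epsilon>)).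
            c = Skip \<and>
            real (used_p s) \<le> 10000000000 * B \<and> real (used_q s) \<le> 10000000000 * B \<and>
            (let N = real (used_p s + used_q s) in real (steps s) \<le> 10000000000 * (N * ln N))) \<and>
         (p = q \<longrightarrow>
            measure_pmf.prob (run p q T (entropy_tester, start n \<epsilon>)) accepting \<ge> 9/10) \<and>
         (\<bar>shannon_entropy p - shannon_entropy q\<bar> \<ge> \<epsilon> \<longrightarrow>
            measure_pmf.prob (run p q T (entropy_tester, start n \<epsilon>)) rejecting \<ge> 9/10)"
    unfolding Let_def L_def[symmetric] B_def[symmetric]
  proof (rule ex_forward[OF entropy_tester_correct[OF \<epsilon>]], elim conjE, intro conjI ballI)
    fix T cs
    assume "\<forall>(c, s) \<in> set_pmf (run p q T (entropy_tester, start n \<epsilon>)).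
        c = Skip \<and> used_p s = 3 * m \<and> used_q s = 3 * m \<and> steps s \<le> 100 * m"
      and "cs \<in> set_pmf (run p q T (entropy_tester, start n \<epsilon>))"
    then have "fst cs = Skip" "used_p (snd cs) = 3 * m" "used_q (snd cs) = 3 * m"
      "steps (snd cs) \<le> 100 * m"
      by auto
    then show "case cs of (c, s) \<Rightarrow> c = Skip \<and>
        real (used_p s) \<le> 10000000000 * B \<and> real (used_q s) \<le> 10000000000 * B \<and>
        real (steps s) \<le> 10000000000 * (real (used_p s + used_q s) * ln (real (used_p s + used_q s)))"
      using mB time[of "steps (snd cs)"] by (simp add: case_prod_unfold)
  qed
qed simp

end
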